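(* Let $A$ be an o-minimal structure over $\mathbb{R}$ and let $X=\{X_1,\ldots,X_k\}$ be a finite collection of nonempty, closed, pairwise disjoint subsets of $\mathbb{R}^2$, definable in $A$. Let $Y=\mathrm{Conf}_{\mathbb{R}^2}(X)$ and let $y_0\in Y$. Then the germ of $Y$ at $y_0$ is the germ of a union of finitely many definable (in $A$) arcs $\gamma_1,\ldots,\gamma_s$, each starting at $y_0$, such that the unit tangent vectors of $\gamma_i$ and $\gamma_j$ at $y_0$ are different for $i\neq j$.
   Context: $\mathbb{R}^2$ carries the Euclidean metric $d$, and $d(x,B)=\inf_{b\in B}d(x,b)$. The territory of $X_i$ is $\mathrm{Ter}_{\mathbb{R}^2}(X_i,X)=\{x\in\mathbb{R}^2 : d(x,X_i)\le d(x,X_j)\text{ for all } j\}$, and the conflict set is $\mathrm{Conf}_{\mathbb{R}^2}(X)=\{x\in\mathbb{R}^2 : x\in \mathrm{Ter}_{\mathbb{R}^2}(X_i,X)\cap \mathrm{Ter}_{\mathbb{R}^2}(X_j,X)\text{ for some } i\neq j\}$. The o-minimal structure is assumed to expand the real field. A definable arc starting at $y_0$ is (the image of) a continuous definable map $\gamma:[0,\varepsilon)\to\mathbb{R}^2$, $\varepsilon>0$, with $\gamma(0)=y_0$ and $|\gamma(t)-y_0|=t$ for all $t$. Its unit tangent vector at $y_0$ is $\lim_{t\to 0^+}(\gamma(t)-y_0)/|\gamma(t)-y_0|$. *)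

theory Defs
  imports "HOL-Analysis.Analysis"
begin

text \<open>
  Points of \<open>R\<^sup>n\<close> with \<open>n\<close> varying are lists of length \<open>n\<close>, so that products of sets are given by
  appending lists and the projection onto the first \<open>n\<close> coordinates is \<^const>\<open>butlast\<close>.
\<close>

definition Rn :: "nat \<Rightarrow> real list set" where
  "Rn n = {xs. length xs = n}"

text \<open>
  Structures and o-minimal structures in the sense of van den Dries: \<open>S n\<close> is the
  collection of the definable subsets of \<open>R\<^sup>n\<close>. \<open>R\<close> itself is \<open>Rn 1\<close>, with \<open>x\<close> written \<open>[x]\<close>.
\<close>

locale real_structure =
  fixes S :: "nat \<Rightarrow> real list set set"
  assumes boolean_algebra: "\<And>n. algebra (Rn n) (S n)"
    and prod_left: "\<And>n A. A \<in> S n \<Longrightarrow> {x # xs | x xs. xs \<in> A} \<in> S (Suc n)"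
    and prod_right: "\<And>n A. A \<in> S n \<Longrightarrow> {xs @ [x] | x xs. xs \<in> A} \<in> S (Suc n)"
    and diagonal: "\<And>n. n \<ge> 1 \<Longrightarrow> {xs \<in> Rn n. hd xs = last xs} \<in> S n"
    and projection: "\<And>n A. A \<in> S (Suc n) \<Longrightarrow> butlast ` A \<in> S n"

text \<open>
  The open intervals \<^term>\<open>einterval a b\<close> have endpoints in the extended reals. As \<open>S 1\<close> contains all
  the singletons, definability is definability with real parameters.
\<close>

locale o_minimal_structure = real_structure +
  assumes less_definable: "{[x, y] | x y. x < y} \<in> S 2"
    and o_minimal: "S 1 = {(\<lambda>x. [x]) ` \<Union>F | F. finite F \<and>
          (\<forall>I\<in>F. (\<exists>c. I = {c}) \<or> (\<exists>a b. a < b \<and> I = einterval a b))}"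

locale o_minimal_field_expansion = o_minimal_structure +
  assumes plus_definable: "{[x, y, x + y] | x y. True} \<in> S 3"
    and times_definable: "{[x, y, x * y] | x y. True} \<in> S 3"

definition definable_set :: "(nat \<Rightarrow> real list set set) \<Rightarrow> (real ^ 2) set \<Rightarrow> bool" where
  "definable_set S B \<longleftrightarrow> {[p $ 1, p $ 2] | p. p \<in> B} \<in> S 2"

text \<open>A map on a subset of \<open>R\<close> is definable iff its graph, a subset of \<open>R\<^sup>3\<close>, is.\<close>

definition definable_map_on ::
  "(nat \<Rightarrow> real list set set) \<Rightarrow> real set \<Rightarrow> (real \<Rightarrow> real ^ 2) \<Rightarrow> bool" where
  "definable_map_on S D \<gamma> \<longleftrightarrow> {[t, \<gamma> t $ 1, \<gamma> t $ 2] | t. t \<in> D} \<in> S 3"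

text \<open>
  A family \<open>X\<^sub>1, \<dots>, X\<^sub>k\<close> is a function on \<^typ>\<open>nat\<close> of which only the values on \<open>{1..k}\<close> matter.
  For nonempty \<open>B\<close>, \<^term>\<open>infdist x B\<close> is the infimum of the distances from \<open>x\<close> to the points of \<open>B\<close>.
\<close>

definition Ter :: "nat \<Rightarrow> (nat \<Rightarrow> (real ^ 2) set) \<Rightarrow> nat \<Rightarrow> (real ^ 2) set" where
  "Ter k X i = {x. \<forall>j\<in>{1..k}. infdist x (X i) \<le> infdist x (X j)}"

definition Conf :: "nat \<Rightarrow> (nat \<Rightarrow> (real ^ 2) set) \<Rightarrow> (real ^ 2) set" where
  "Conf k X = {x. \<exists>i\<in>{1..k}. \<exists>j\<in>{1..k}. i \<noteq> j \<and> x \<in> Ter k X i \<inter> Ter k X j}"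

text \<open>The arc as a point set is \<open>\<gamma> ` {0..<\<epsilon>}\<close>; values of \<open>\<gamma>\<close> outside \<open>{0..<\<epsilon>}\<close> are irrelevant.\<close>

definition definable_arc ::
  "(nat \<Rightarrow> real list set set) \<Rightarrow> real ^ 2 \<Rightarrow> real \<Rightarrow> (real \<Rightarrow> real ^ 2) \<Rightarrow> bool" where
  "definable_arc S y0 \<epsilon> \<gamma> \<longleftrightarrow>
     \<epsilon> > 0 \<and> continuous_on {0..<\<epsilon>} \<gamma> \<and> definable_map_on S {0..<\<epsilon>} \<gamma> \<and>
     \<gamma> 0 = y0 \<and> (\<forall>t\<in>{0..<\<epsilon>}. norm (\<gamma> t - y0) = t)"

definition has_unit_tangent :: "(real \<Rightarrow> real ^ 2) \<Rightarrow> real ^ 2 \<Rightarrow> real ^ 2 \<Rightarrow> bool" where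
  "has_unit_tangent \<gamma> y0 u \<longleftrightarrow>
     ((\<lambda>t. (\<gamma> t - y0) /\<^sub>R norm (\<gamma> t - y0)) \<longlongrightarrow> u) (at_right 0)"

definition same_germ :: "'a::topological_space \<Rightarrow> 'a set \<Rightarrow> 'a set \<Rightarrow> bool" where
  "same_germ y0 A B \<longleftrightarrow> (\<exists>U. open U \<and> y0 \<in> U \<and> A \<inter> U = B \<inter> U)"

end

theory Submission
  imports Defs
begin

text \<open>
  Let \<open>x\<close> be a conflict point near \<open>y0\<close>, in direction \<open>u\<close> from \<open>y0\<close>. The sites nearest to \<open>x\<close> are close
  to those points of the union of the \<open>X\<^sub>i\<close> nearest to \<open>y0\<close> that are extremal in direction \<open>u\<close>. As there
  are at most two of these, on a line orthogonal to \<open>u\<close>, monotonicity of nearest point maps shows that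
  in a small cone around \<open>u\<close> the conflict set has at most one point at each small distance from
  \<open>y0\<close>. By compactness, finitely many such cones suffice. In each of them, o-minimality in dimension one
  shows that the point exists for all small distances or for none, and that the resulting curve has
  a tangent; it is continuous because its graph is closed. Two of these curves with the same tangent
  lie in a common cone, hence coincide near \<open>y0\<close>. There is at least one curve because a punctured disc
  is connected.
\<close>

section \<open>First-order definability\<close>

context real_structure
begin

lemma sets_into_Rn: "A \<in> S n \<Longrightarrow> A \<subseteq> Rn n"
  using boolean_algebra[of n] by (auto simp: algebra_iff_Un)

lemma Rn_in: "Rn n \<in> S n"
  using algebra.top[OF boolean_algebra] .

lemma Int_in: "A \<in> S n \<Longrightarrow> B \<in> S n \<Longrightarrow> A \<inter> B \<in> S n"
  using semiring_of_sets.Int[OF ring_of_sets.axioms(1)[OF algebra.axioms(1)[OF boolean_algebra]]] .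

lemma Diff_in: "A \<in> S n \<Longrightarrow> B \<in> S n \<Longrightarrow> A - B \<in> S n"
  using ring_of_sets.Diff[OF algebra.axioms(1)[OF boolean_algebra]] .

section \<open>Cylinders, projections and coordinate substitution for definable sets\<close>

lemma pad_right:
  assumes "A \<in> S n"
  shows "{xs \<in> Rn (n + k). take n xs \<in> A} \<in> S (n + k)"
proof (induction k)
  case 0
  have "{xs \<in> Rn n. take n xs \<in> A} = A"
    using sets_into_Rn[OF assms] by (auto simp: Rn_def)
  then show ?case using assms by simp
next
  case (Suc k)
  have "{xs \<in> Rn (n + Suc k). take n xs \<in> A}
      = {xs @ [x] | x xs. xs \<in> {xs \<in> Rn (n + k). take n xs \<in> A}}" (is "?L = ?R")
  proof
    show "?L \<subseteq> ?R"
    proof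
      fix xs assume xs: "xs \<in> ?L"
      then have "xs = butlast xs @ [last xs]" "length xs = Suc (n + k)"
        by (auto simp: Rn_def intro!: append_butlast_last_id[symmetric])
      moreover have "take n (butlast xs) = take n xs"
        using \<open>length xs = Suc (n + k)\<close> by (simp add: take_butlast)
      ultimately show "xs \<in> ?R"
        using xs by (auto simp: Rn_def intro!: exI[of _ "last xs"] exI[of _ "butlast xs"])
    qed
  qed (auto simp: Rn_def)
  then show ?case using prod_right[OF Suc] by simp
qed

lemma pad_left:
  assumes "A \<in> S n"
  shows "{xs \<in> Rn (k + n). drop k xs \<in> A} \<in> S (k + n)"
proof (induction k)
  case 0
  have "{xs \<in> Rn n. xs \<in> A} = A"
    using sets_into_Rn[OF assms] by auto
  then show ?case using assms by simp
next
  case (Suc k)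
  have "{xs \<in> Rn (Suc k + n). drop (Suc k) xs \<in> A}
      = {x # xs | x xs. xs \<in> {xs \<in> Rn (k + n). drop k xs \<in> A}}" (is "?L = ?R")
  proof
    show "?L \<subseteq> ?R"
    proof
      fix xs assume xs: "xs \<in> ?L"
      then obtain y ys where "xs = y # ys" by (cases xs) (auto simp: Rn_def)
      then show "xs \<in> ?R" using xs by (auto simp: Rn_def)
    qed
  qed (auto simp: Rn_def)
  then show ?case using prod_left[OF Suc] by simp
qed

text \<open>The axiom \<open>diagonal\<close> compares only the first with the last coordinate. For
  \<open>i \<le> j\<close> it is applied to the block of coordinates from \<open>i\<close> to
  \<open>j\<close>, which is then padded on both sides.\<close>

lemma nth_eq_in:
  assumes "i < n" "j < n"
  shows "{xs \<in> Rn n. xs ! i = xs ! j} \<in> S n"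
proof -
  have *: "{xs \<in> Rn n. xs ! i = xs ! j} \<in> S n" if "i \<le> j" "j < n" for i j
  proof -
    define m where "m = Suc (j - i)"
    define D where "D = {xs \<in> Rn m. hd xs = last xs}"
    have D: "D \<in> S m" unfolding D_def by (rule diagonal) (simp add: m_def)
    have "i + m \<le> n" using that by (simp add: m_def)
    then obtain k where n: "n = i + m + k"
      using le_Suc_ex by blast
    have "{xs \<in> Rn n. take (i + m) xs \<in> {xs \<in> Rn (i + m). drop i xs \<in> D}} \<in> S n"
      unfolding n by (intro pad_right pad_left D)
    also have "{xs \<in> Rn n. take (i + m) xs \<in> {xs \<in> Rn (i + m). drop i xs \<in> D}}
        = {xs \<in> Rn n. xs ! i = xs ! j}"
      using that by (auto simp: D_def Rn_def n m_def hd_conv_nth last_conv_nth)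
    finally show ?thesis .
  qed
  show ?thesis
  proof (cases "i \<le> j")
    case True
    then show ?thesis using * assms by blast
  next
    case False
    then have "{xs \<in> Rn n. xs ! j = xs ! i} \<in> S n" using * assms by simp
    moreover have "{xs \<in> Rn n. xs ! j = xs ! i} = {xs \<in> Rn n. xs ! i = xs ! j}" by auto
    ultimately show ?thesis by simp
  qed
qed

lemma take_image_in:
  assumes "A \<in> S (m + k)"
  shows "take m ` A \<in> S m"
  using assms
proof (induction k arbitrary: A)
  case 0
  have "take m ` A = A"
    using sets_into_Rn[OF 0] by (force simp: Rn_def)
  then show ?case using 0 by simp
next
  case (Suc k)
  have "butlast ` A \<in> S (m + k)" using projection Suc.prems by simp
  then have "take m ` butlast ` A \<in> S m" by (rule Suc.IH)
  moreover have "take m (butlast xs) = take m xs" if "xs \<in> A" for xs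
    using that sets_into_Rn[OF Suc.prems] by (auto simp: Rn_def take_butlast)
  ultimately show ?case by (simp add: image_image cong: image_cong_simp)
qed

lemma Ball_in:
  assumes "finite I" "\<And>i. i \<in> I \<Longrightarrow> {xs \<in> Rn n. P i xs} \<in> S n"
  shows "{xs \<in> Rn n. \<forall>i\<in>I. P i xs} \<in> S n"
  using assms
proof (induction I rule: finite_induct)
  case empty
  then show ?case using Rn_in by simp
next
  case (insert i I)
  have "{xs \<in> Rn n. \<forall>i\<in>insert i I. P i xs} = {xs \<in> Rn n. P i xs} \<inter> {xs \<in> Rn n. \<forall>i\<in>I. P i xs}"
    by auto
  then show ?case using insert by (auto intro!: Int_in)
qed

text \<open>The selected tuple is appended as \<open>n\<close> new coordinates, which are
  constrained to agree with the coordinates \<open>\<sigma> i\<close> and to form a point of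
  \<open>A\<close>, and is then projected away. This covers permuted, repeated and dummy variables
  alike.\<close>

lemma reindex_in:
  assumes A: "A \<in> S n" and \<sigma>: "\<And>i. i < n \<Longrightarrow> \<sigma> i < m"
  shows "{xs \<in> Rn m. map (\<lambda>i. xs ! \<sigma> i) [0..<n] \<in> A} \<in> S m"
proof -
  define B where "B = {zs \<in> Rn (m + n). drop m zs \<in> A}
      \<inter> {zs \<in> Rn (m + n). \<forall>i\<in>{..<n}. zs ! \<sigma> i = zs ! (m + i)}"
  have "B \<in> S (m + n)" unfolding B_def
    by (intro Int_in pad_left A Ball_in nth_eq_in) (auto dest!: \<sigma>)
  then have "take m ` B \<in> S m" by (rule take_image_in)
  also have "take m ` B = {xs \<in> Rn m. map (\<lambda>i. xs ! \<sigma> i) [0..<n] \<in> A}" (is "_ = ?R")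
  proof
    show "take m ` B \<subseteq> ?R"
    proof
      fix xs assume "xs \<in> take m ` B"
      then obtain zs where zs: "zs \<in> B" "xs = take m zs" by auto
      have "map (\<lambda>i. xs ! \<sigma> i) [0..<n] = drop m zs"
        using zs \<sigma> by (intro nth_equalityI) (auto simp: B_def Rn_def)
      then show "xs \<in> ?R" using zs by (auto simp: B_def Rn_def)
    qed
    show "?R \<subseteq> take m ` B"
    proof
      fix xs assume xs: "xs \<in> ?R"
      define zs where "zs = xs @ map (\<lambda>i. xs ! \<sigma> i) [0..<n]"
      have "zs \<in> B" using xs \<sigma> by (auto simp: B_def Rn_def zs_def nth_append)
      moreover have "take m zs = xs" using xs by (simp add: zs_def Rn_def)
      ultimately show "xs \<in> take m ` B" by force
    qed
  qed
  finally show ?thesis .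
qed

text \<open>
  Formulas are predicates on environments \<open>e\<close>, which assign a real to every de Bruijn index; a
  quantifier binds index 0, whence the shifted environment \<open>\<lambda>i. e (Suc i)\<close> below.
\<close>

definition definable :: "((nat \<Rightarrow> real) \<Rightarrow> bool) \<Rightarrow> bool" where
  "definable P \<longleftrightarrow> (\<exists>n. \<exists>A\<in>S n. \<forall>e. P e \<longleftrightarrow> map e [0..<n] \<in> A)"

definition definable_fun :: "((nat \<Rightarrow> real) \<Rightarrow> real) \<Rightarrow> bool" where
  "definable_fun f \<longleftrightarrow> definable (\<lambda>e. e 0 = f (\<lambda>i. e (Suc i)))"

lemma definableI: "A \<in> S n \<Longrightarrow> (\<And>e. P e \<longleftrightarrow> map e [0..<n] \<in> A) \<Longrightarrow> definable P"
  unfolding definable_def by blast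

text \<open>Dummy coordinates can be appended, so several predicates can be represented by subsets
  of one common space.\<close>

lemma definable_arity:
  assumes "definable P"
  obtains n where "\<And>m. n \<le> m \<Longrightarrow> \<exists>A\<in>S m. \<forall>e. P e \<longleftrightarrow> map e [0..<m] \<in> A"
proof -
  obtain n A where A: "A \<in> S n" "\<And>e. P e \<longleftrightarrow> map e [0..<n] \<in> A"
    using assms unfolding definable_def by blast
  have "\<exists>A\<in>S m. \<forall>e. P e \<longleftrightarrow> map e [0..<m] \<in> A" if "n \<le> m" for m
  proof -
    obtain k where m: "m = n + k" using \<open>n \<le> m\<close> nat_le_iff_add by blast
    have "map e [0..<m] \<in> {xs \<in> Rn m. take n xs \<in> A} \<longleftrightarrow> P e" for e
      by (auto simp: A(2) Rn_def m take_map)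
    with pad_right[OF A(1), of k] m show ?thesis by blast
  qed
  then show thesis using that by blast
qed

lemma definable_reindex:
  assumes "definable P"
  shows "definable (\<lambda>e. P (\<lambda>i. e (\<sigma> i)))"
proof -
  obtain n A where A: "A \<in> S n" "\<And>e. P e \<longleftrightarrow> map e [0..<n] \<in> A"
    using assms unfolding definable_def by blast
  obtain m where m: "\<And>i. i < n \<Longrightarrow> \<sigma> i < m"
    by (metis finite_imageI finite_lessThan finite_nat_iff_bounded image_subset_iff lessThan_iff)
  show ?thesis
  proof (rule definableI[OF reindex_in[OF A(1) m]])
    fix e :: "nat \<Rightarrow> real"
    have "map (\<lambda>i. map e [0..<m] ! \<sigma> i) [0..<n] = map (\<lambda>i. e (\<sigma> i)) [0..<n]"
      using m by auto
    then show "P (\<lambda>i. e (\<sigma> i)) \<longleftrightarrow>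
        map e [0..<m] \<in> {xs \<in> Rn m. map (\<lambda>i. xs ! \<sigma> i) [0..<n] \<in> A}"
      by (simp add: A(2) Rn_def del: map_eq_conv)
  qed
qed

section \<open>Closure of definable predicates under connectives, quantifiers and
  substitution\<close>

lemma definable_not:
  assumes "definable P"
  shows "definable (\<lambda>e. \<not> P e)"
proof -
  obtain n A where A: "A \<in> S n" "\<And>e. P e \<longleftrightarrow> map e [0..<n] \<in> A"
    using assms unfolding definable_def by blast
  show ?thesis by (rule definableI[OF Diff_in[OF Rn_in A(1)]]) (simp add: A(2) Rn_def)
qed

lemma definable_conj:
  assumes "definable P" "definable Q"
  shows "definable (\<lambda>e. P e \<and> Q e)"
proof -
  obtain n1 where n1: "\<And>m. n1 \<le> m \<Longrightarrow> \<exists>A\<in>S m. \<forall>e. P e \<longleftrightarrow> map e [0..<m] \<in> A"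
    using definable_arity[OF assms(1)] by blast
  obtain n2 where n2: "\<And>m. n2 \<le> m \<Longrightarrow> \<exists>A\<in>S m. \<forall>e. Q e \<longleftrightarrow> map e [0..<m] \<in> A"
    using definable_arity[OF assms(2)] by blast
  obtain A B where "A \<in> S (max n1 n2)" "\<And>e. P e \<longleftrightarrow> map e [0..<max n1 n2] \<in> A"
    "B \<in> S (max n1 n2)" "\<And>e. Q e \<longleftrightarrow> map e [0..<max n1 n2] \<in> B"
    using n1[of "max n1 n2"] n2[of "max n1 n2"] by auto
  then show ?thesis by (intro definableI[OF Int_in[of A _ B]]) auto
qed

lemma definable_disj: "definable P \<Longrightarrow> definable Q \<Longrightarrow> definable (\<lambda>e. P e \<or> Q e)"
proof -
  assume "definable P" "definable Q"
  then have "definable (\<lambda>e. \<not> (\<not> P e \<and> \<not> Q e))"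
    by (intro definable_not definable_conj)
  then show ?thesis by simp
qed

lemma definable_imp: "definable P \<Longrightarrow> definable Q \<Longrightarrow> definable (\<lambda>e. P e \<longrightarrow> Q e)"
  unfolding imp_conv_disj by (intro definable_disj definable_not)

lemma definable_const: "definable (\<lambda>e. b)"
proof (cases b)
  case True
  then show ?thesis by (intro definableI[OF Rn_in[of 0]]) (simp add: Rn_def)
next
  case False
  then show ?thesis by (intro definableI[OF Diff_in[OF Rn_in Rn_in, of 0]]) simp
qed

lemma definable_ex:
  assumes "definable (\<lambda>e. P (\<lambda>i. e (Suc i)) (e 0))"
  shows "definable (\<lambda>e. \<exists>y. P e y)"
proof -
  define Q where "Q e = P (\<lambda>i. e (Suc i)) (e 0)" for e :: "nat \<Rightarrow> real"
  obtain n0 where n0: "\<And>m. n0 \<le> m \<Longrightarrow> \<exists>A\<in>S m. \<forall>e. Q e \<longleftrightarrow> map e [0..<m] \<in> A"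
    using definable_arity assms unfolding Q_def by blast
  \<comment> \<open>A positive arity guarantees a coordinate for the bound variable, even if
    \<open>P\<close> ignores it.\<close>
  obtain n A where A: "A \<in> S (Suc n)" "\<And>e. Q e \<longleftrightarrow> map e [0..<Suc n] \<in> A"
    using n0[of "Suc n0"] by auto
  \<comment> \<open>The bound variable is coordinate 0, whereas \<open>projection\<close> removes
    the last one; \<open>\<sigma>\<close> describes the rotation that moves it to the end.\<close>
  define \<sigma> where "\<sigma> = case_nat n id"
  define B where "B = {xs \<in> Rn (Suc n). map (\<lambda>i. xs ! \<sigma> i) [0..<Suc n] \<in> A}"
  have B: "B \<in> S (Suc n)" unfolding B_def
    by (rule reindex_in[OF A(1)]) (auto simp: \<sigma>_def split: nat.splits)
  have 1: "P e y \<longleftrightarrow> map e [0..<n] @ [y] \<in> B" for e y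
  proof -
    have "map (\<lambda>i. (map e [0..<n] @ [y]) ! \<sigma> i) [0..<Suc n] = map (case_nat y e) [0..<Suc n]"
      by (rule map_cong) (auto simp: \<sigma>_def nth_append split: nat.splits)
    then show ?thesis
      using A(2)[of "case_nat y e"] by (simp add: B_def Rn_def Q_def del: upt_Suc map_eq_conv)
  qed
  have 2: "(\<exists>y. xs @ [y] \<in> B) \<longleftrightarrow> xs \<in> butlast ` B" for xs
  proof
    assume "xs \<in> butlast ` B"
    then obtain zs where "zs \<in> B" "xs = butlast zs" by auto
    moreover then have "zs \<noteq> []" by (auto simp: B_def Rn_def)
    ultimately show "\<exists>y. xs @ [y] \<in> B" by (metis append_butlast_last_id)
  qed force
  show ?thesis by (rule definableI[OF projection[OF B]]) (simp add: 1 2)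
qed

lemma definable_all:
  assumes "definable (\<lambda>e. P (\<lambda>i. e (Suc i)) (e 0))"
  shows "definable (\<lambda>e. \<forall>y. P e y)"
proof -
  have "definable (\<lambda>e. \<not> (\<exists>y. \<not> P e y))"
    by (rule definable_not, rule definable_ex, rule definable_not[OF assms])
  then show ?thesis by simp
qed

lemma definable_Bex:
  assumes "finite I" "\<And>i. i \<in> I \<Longrightarrow> definable (P i)"
  shows "definable (\<lambda>e. \<exists>i\<in>I. P i e)"
  using assms by (induction I rule: finite_induct) (auto intro: definable_const definable_disj)

lemma definable_var_eq: "definable (\<lambda>e. e i = e j)"
  by (rule definableI[OF nth_eq_in[of i "Suc (max i j)" j]]) (auto simp: Rn_def simp del: upt_Suc)

lemma definable_fun_var: "definable_fun (\<lambda>e. e i)"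
  unfolding definable_fun_def by (rule definable_var_eq)

text \<open>Substituting a term amounts to quantifying over its value:
  \<open>\<exists>y. y = f e \<and> P e y\<close>.\<close>

lemma definable_subst:
  assumes "definable (\<lambda>e. P (\<lambda>i. e (Suc i)) (e 0))" "definable_fun f"
  shows "definable (\<lambda>e. P e (f e))"
proof -
  have "definable (\<lambda>e. \<exists>y. y = f e \<and> P e y)"
    by (rule definable_ex, rule definable_conj[OF assms(2)[unfolded definable_fun_def] assms(1)])
  then show ?thesis by simp
qed

text \<open>Weakening under a binder: index 0, the value of the term, stays in place, and the
  arguments move past the new variable at index 1.\<close>

lemma definable_fun_shift:
  assumes "definable_fun f"
  shows "definable_fun (\<lambda>e. f (\<lambda>i. e (Suc i)))"
  using definable_reindex[OF assms[unfolded definable_fun_def], of "case_nat 0 (\<lambda>i. Suc (Suc i))"]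
  unfolding definable_fun_def by simp

lemma definable_subst3:
  assumes "definable (\<lambda>e. P (e 0) (e 1) (e 2))"
    "definable_fun f" "definable_fun g" "definable_fun h"
  shows "definable (\<lambda>e. P (f e) (g e) (h e))"
proof -
  \<comment> \<open>Reversing the three variables puts the third argument at index 0. The arguments
    are then replaced from last to first, so \<open>h\<close> is shifted past the two variables that
    remain and \<open>g\<close> past one.\<close>
  let ?\<sigma> = "case_nat (2::nat) (case_nat 1 (\<lambda>_. 0))"
  have "definable (\<lambda>e. P (e (Suc 1)) (e (Suc 0)) (e 0))"
    using definable_reindex[OF assms(1), of ?\<sigma>] by (simp add: numeral_2_eq_2)
  then have "definable (\<lambda>e. P (e 1) (e 0) (h (\<lambda>i. e (Suc (Suc i)))))"
    by (rule definable_subst[of "\<lambda>e. P (e 1) (e 0)"])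
      (rule definable_fun_shift[OF definable_fun_shift[OF assms(4)]])
  then have "definable (\<lambda>e. P (e (Suc 0)) (e 0) (h (\<lambda>i. e (Suc (Suc i)))))"
    by simp
  then have "definable (\<lambda>e. P (e 0) (g (\<lambda>i. e (Suc i))) (h (\<lambda>i. e (Suc i))))"
    by (rule definable_subst[of "\<lambda>e y. P (e 0) y (h (\<lambda>i. e (Suc i)))"])
      (rule definable_fun_shift[OF assms(3)])
  then show ?thesis
    by (rule definable_subst[of "\<lambda>e y. P y (g e) (h e)"]) (rule assms(2))
qed

lemma definable_subst2:
  assumes "definable (\<lambda>e. P (e 0) (e 1))" "definable_fun f" "definable_fun g"
  shows "definable (\<lambda>e. P (f e) (g e))"
  using definable_subst3[of "\<lambda>x y z. P x y"] assms by blast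

lemma definable_eq: "definable_fun f \<Longrightarrow> definable_fun g \<Longrightarrow> definable (\<lambda>e. f e = g e)"
  by (rule definable_subst2[where P = "(=)"]) (rule definable_var_eq)

text \<open>The way back from predicates to sets. The set representing \<open>P\<close> may live in
  too many coordinates; since \<open>P\<close> depends on the first \<open>m\<close> only,
  projecting the others away does no harm.\<close>

lemma definable_imp_in:
  assumes "definable P" and P: "\<And>e e'. (\<And>i. i < m \<Longrightarrow> e i = e' i) \<Longrightarrow> P e = P e'"
  shows "{xs \<in> Rn m. P (\<lambda>i. xs ! i)} \<in> S m"
proof -
  obtain n where "\<And>m. n \<le> m \<Longrightarrow> \<exists>A\<in>S m. \<forall>e. P e \<longleftrightarrow> map e [0..<m] \<in> A"
    using definable_arity[OF assms(1)] by blast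
  from this[of "m + n"] obtain A
    where A: "A \<in> S (m + n)" "\<And>e. P e \<longleftrightarrow> map e [0..<m + n] \<in> A"
    by auto
  have "take m ` A = {xs \<in> Rn m. P (\<lambda>i. xs ! i)}" (is "_ = ?R")
  proof
    show "take m ` A \<subseteq> ?R"
    proof
      fix xs assume "xs \<in> take m ` A"
      then obtain zs where zs: "zs \<in> A" "xs = take m zs" by auto
      then have len: "length zs = m + n" using sets_into_Rn[OF A(1)] by (auto simp: Rn_def)
      then have "map ((!) zs) [0..<m + n] = zs" by (metis map_nth)
      then have "P (\<lambda>i. zs ! i)" using zs by (simp add: A(2))
      moreover have "P (\<lambda>i. xs ! i) = P (\<lambda>i. zs ! i)" by (rule P) (simp add: zs(2))
      ultimately have "P (\<lambda>i. xs ! i)" by simp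
      then show "xs \<in> ?R" using zs len by (simp add: Rn_def)
    qed
    show "?R \<subseteq> take m ` A"
    proof
      fix xs assume xs: "xs \<in> ?R"
      \<comment> \<open>Entries past the end of \<open>xs\<close> are unspecified, but they are the
        same ones that the environment \<open>\<lambda>i. xs ! i\<close> supplies.\<close>
      define zs where "zs = map ((!) xs) [0..<m + n]"
      have "zs \<in> A" using xs by (simp add: A(2) zs_def)
      moreover have "take m zs = xs" using xs
        by (intro nth_equalityI) (auto simp: zs_def Rn_def)
      ultimately show "xs \<in> take m ` A" by force
    qed
  qed
  then show ?thesis using take_image_in[OF A(1)] by simp
qed

lemma definable_set_in:
  assumes "definable_set S B"
  shows "definable (\<lambda>e. vector [e i, e j] \<in> B)"
proof -
  have "definable (\<lambda>e. (vector [e 0, e 1] :: real ^ 2) \<in> B)"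
    using assms unfolding definable_set_def
  proof (rule definableI)
    fix e :: "nat \<Rightarrow> real"
    let ?p = "vector [e 0, e 1] :: real ^ 2"
    have "map e [0..<2] = [?p $ 1, ?p $ 2]" by (simp add: upt_rec)
    moreover have "p = q" if "[p $ 1, p $ 2] = [q $ 1, q $ 2]" for p q :: "real ^ 2"
      using that by (simp add: vec_eq_iff forall_2)
    ultimately show "?p \<in> B \<longleftrightarrow> map e [0..<2] \<in> {[p $ 1, p $ 2] | p. p \<in> B}"
      unfolding mem_Collect_eq by metis
  qed
  then show ?thesis
    using definable_reindex[of "\<lambda>e. (vector [e 0, e 1] :: real ^ 2) \<in> B" "case_nat i (\<lambda>_. j)"] by simp
qed

end

text \<open>Reduces a quantifier over plane points to two real quantifiers, the only ones that the
  formula calculus has.\<close>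

lemma ex_real2: "(\<exists>p :: real ^ 2. P p) \<longleftrightarrow> (\<exists>a b. P (vector [a, b]))"
proof
  assume "\<exists>p :: real ^ 2. P p"
  then obtain p :: "real ^ 2" where "P p" by blast
  moreover have "p = vector [p $ 1, p $ 2]" by (simp add: vec_eq_iff forall_2)
  ultimately have "P (vector [p $ 1, p $ 2])" by simp
  then show "\<exists>a b. P (vector [a, b])" by blast
qed blast

lemma all_real2: "(\<forall>p :: real ^ 2. P p) \<longleftrightarrow> (\<forall>a b. P (vector [a, b]))"
proof -
  have "(\<exists>p. \<not> P p) \<longleftrightarrow> (\<exists>a b. \<not> P (vector [a, b]))" by (rule ex_real2)
  then show ?thesis by blast
qed

context real_structure
begin

lemma definable_ex_real2:
  assumes "definable (\<lambda>e. P (\<lambda>i. e (Suc (Suc i))) (vector [e 1, e 0]))"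
  shows "definable (\<lambda>e. \<exists>p :: real ^ 2. P e p)"
  unfolding ex_real2 by (rule definable_ex, rule definable_ex) (use assms in simp)

lemma definable_all_real2:
  assumes "definable (\<lambda>e. P (\<lambda>i. e (Suc (Suc i))) (vector [e 1, e 0]))"
  shows "definable (\<lambda>e. \<forall>p :: real ^ 2. P e p)"
  unfolding all_real2 by (rule definable_all, rule definable_all) (use assms in simp)

end

section \<open>Definable arithmetic and one-sided germs of definable subsets of the line\<close>

context o_minimal_field_expansion
begin

lemma definable_fun_const: "definable_fun (\<lambda>e. c)"
  unfolding definable_fun_def
proof (rule definableI[of _ 1])
  have "(\<lambda>x. [x]) ` \<Union>{{c}} \<in> S 1" unfolding o_minimal
    by (intro CollectI exI[of _ "{{c}}"]) auto
  then show "{[c]} \<in> S 1" by simp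
qed simp

lemma definable_fun_binop:
  assumes "{[x, y, h x y] | x y. True} \<in> S 3" "definable_fun f" "definable_fun g"
  shows "definable_fun (\<lambda>e. h (f e) (g e))"
proof -
  have "definable (\<lambda>e. e 2 = h (e 0) (e 1))"
    by (rule definableI[OF assms(1)]) (auto simp: numeral_3_eq_3 numeral_2_eq_2)
  then show ?thesis
    unfolding definable_fun_def
    by (rule definable_subst3[OF _ definable_fun_shift[OF assms(2)] definable_fun_shift[OF assms(3)] definable_fun_var])
qed

lemmas definable_fun_plus = definable_fun_binop[OF plus_definable]
lemmas definable_fun_times = definable_fun_binop[OF times_definable]

lemma definable_fun_minus:
  assumes "definable_fun f" "definable_fun g"
  shows "definable_fun (\<lambda>e. f e - g e)"
proof -
  have "definable_fun (\<lambda>e. f e + (- 1) * g e)"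
    by (intro definable_fun_plus definable_fun_times definable_fun_const assms)
  then show ?thesis by simp
qed

lemma definable_fun_power2:
  "definable_fun f \<Longrightarrow> definable_fun (\<lambda>e. (f e)\<^sup>2)"
  unfolding power2_eq_square by (intro definable_fun_times)

lemma definable_less:
  assumes "definable_fun f" "definable_fun g"
  shows "definable (\<lambda>e. f e < g e)"
proof (rule definable_subst2[where P = "(<)", OF _ assms])
  show "definable (\<lambda>e. e 0 < e 1)"
    by (rule definableI[OF less_definable]) (auto simp: numeral_2_eq_2)
qed

lemma definable_le:
  "definable_fun f \<Longrightarrow> definable_fun g \<Longrightarrow> definable (\<lambda>e. f e \<le> g e)"
  unfolding not_less[symmetric] by (intro definable_not definable_less)

lemmas definable_intros = definable_not definable_conj definable_disj definable_imp definable_const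
  definable_ex definable_all definable_ex_real2 definable_all_real2 definable_eq definable_less definable_le
  definable_fun_var definable_fun_const definable_fun_plus definable_fun_times definable_fun_minus
  definable_fun_power2

text \<open>Here the finiteness in \<open>o_minimal\<close> enters: each of the finitely many points
  and intervals either contains or misses some interval \<open>(0, c)\<close>, and finitely many
  such statements hold simultaneously.\<close>

lemma definable_eventually_at_right:
  assumes "definable (\<lambda>e. P (e 0))"
  shows "eventually P (at_right 0) \<or> eventually (\<lambda>t. \<not> P t) (at_right 0)"
proof -
  have "{xs \<in> Rn 1. P (xs ! 0)} \<in> S 1"
    by (rule definable_imp_in[OF assms]) simp
  then have "\<exists>F. {xs \<in> Rn 1. P (xs ! 0)} = (\<lambda>x. [x]) ` \<Union>F \<and> finite F \<and>
      (\<forall>I\<in>F. (\<exists>c. I = {c}) \<or> (\<exists>a b. a < b \<and> I = einterval a b))"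
    unfolding o_minimal by (rule CollectD)
  then obtain F where F: "finite F" "{xs \<in> Rn 1. P (xs ! 0)} = (\<lambda>x. [x]) ` \<Union>F"
    and F': "\<And>I. I \<in> F \<Longrightarrow> (\<exists>c. I = {c}) \<or> (\<exists>a b. a < b \<and> I = einterval a b)"
    by metis
  have P: "P t \<longleftrightarrow> (\<exists>I\<in>F. t \<in> I)" for t
  proof -
    have "P t \<longleftrightarrow> [t] \<in> {xs \<in> Rn 1. P (xs ! 0)}" by (simp add: Rn_def)
    then show ?thesis unfolding F(2) by auto
  qed
  have *: "eventually (\<lambda>t. t \<in> I) (at_right 0) \<or> eventually (\<lambda>t. t \<notin> I) (at_right 0)"
    if "I \<in> F" for I
  proof -
    have pos: "eventually (\<lambda>t::real. t > 0) (at_right 0)" by (simp add: eventually_at_right_less)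
    have lt: "eventually (\<lambda>t. ereal t < a) (at_right 0)" if a: "a > 0" for a
    proof -
      \<comment> \<open>The endpoint \<open>a\<close> may be infinite, so a real number is chosen
        below it.\<close>
      obtain c where c: "ereal 0 < ereal c" "ereal c < a"
        using ereal_dense2[of "ereal 0" a] a unfolding zero_ereal_def by blast
      have "eventually (\<lambda>t. t < c) (at_right 0)"
        using c by (auto simp: eventually_at_right_field)
      then show ?thesis by eventually_elim (use c in \<open>meson less_ereal.simps(1) less_trans\<close>)
    qed
    from F'[OF that] consider c where "I = {c}" | a b where "a < b" "I = einterval a b" by blast
    then show ?thesis
    proof cases
      case (1 c)
      have "eventually (\<lambda>t. t \<noteq> c) (at_right 0)"
      proof (cases "c > 0")
        case True
        with lt[of c] show ?thesis by (auto elim: eventually_mono)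
      next
        case False
        from pos show ?thesis by eventually_elim (use False in auto)
      qed
      with 1 show ?thesis by simp
    next
      case (2 a b)
      \<comment> \<open>The interval starts to the right of 0, ends at or before 0, or reaches from
        at most 0 to beyond it; only in the last case does it contain all small positive
        \<open>t\<close>.\<close>
      consider "a > 0" | "b \<le> 0" | "a \<le> 0" "b > 0" by fastforce
      then show ?thesis
      proof cases
        case 1
        from lt[OF 1] have "eventually (\<lambda>t. t \<notin> I) (at_right 0)"
          by eventually_elim (use 2 in \<open>auto simp: einterval_def\<close>)
        then show ?thesis ..
      next
        case b: 2
        from pos have "eventually (\<lambda>t. t \<notin> I) (at_right 0)"
        proof eventually_elim
          case (elim t)
          then have "\<not> ereal t < b" using b by (metis ereal_less(2) leD less_trans order.strict_trans2)
          then show ?case using 2 by (auto simp: einterval_def)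
        qed
        then show ?thesis ..
      next
        case ab: 3
        from pos lt[OF ab(2)] have "eventually (\<lambda>t. t \<in> I) (at_right 0)"
        proof eventually_elim
          case (elim t)
          then have "a < ereal t" using ab by (metis ereal_less(2) order.strict_trans1)
          then show ?case using 2 elim by (auto simp: einterval_def)
        qed
        then show ?thesis ..
      qed
    qed
  qed
  show ?thesis
  proof (cases "\<exists>I\<in>F. eventually (\<lambda>t. t \<in> I) (at_right 0)")
    case True
    then obtain I where "I \<in> F" "eventually (\<lambda>t. t \<in> I) (at_right 0)" by blast
    then have "eventually P (at_right 0)" by (elim eventually_mono) (use P \<open>I \<in> F\<close> in blast)
    then show ?thesis ..
  next
    case False
    with * have "eventually (\<lambda>t. \<forall>I\<in>F. t \<notin> I) (at_right 0)"
      by (intro eventually_ball_finite F) blast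
    then show ?thesis by (simp add: P)
  qed
qed

end

text \<open>The limit is the supremum of the eventual lower bounds. A number above it is not an
  eventual lower bound, so by the dichotomy it is a strict eventual upper bound.\<close>

lemma bounded_real_limit_exists:
  fixes h :: "'a \<Rightarrow> real"
  assumes F: "F \<noteq> bot" and bounded: "eventually (\<lambda>t. \<bar>h t\<bar> \<le> B) F"
    and dichotomy: "\<And>c. eventually (\<lambda>t. h t < c) F \<or> eventually (\<lambda>t. \<not> h t < c) F"
  shows "\<exists>l. (h \<longlongrightarrow> l) F"
proof -
  define C where "C = {c. eventually (\<lambda>t. c \<le> h t) F}"
  have "- B \<in> C" unfolding C_def using bounded by (auto elim!: eventually_mono)
  have "c \<le> B" if "c \<in> C" for c
  proof -
    from that bounded have "eventually (\<lambda>t. c \<le> B) F"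
      unfolding C_def by (auto elim: eventually_elim2)
    then show ?thesis using F by simp
  qed
  then have bdd: "bdd_above C" unfolding bdd_above_def by blast
  have "(h \<longlongrightarrow> Sup C) F"
  proof (rule order_tendstoI)
    fix a assume "a < Sup C"
    then obtain c where "c \<in> C" "a < c" using less_cSup_iff[OF _ bdd] \<open>- B \<in> C\<close> by auto
    then show "eventually (\<lambda>t. a < h t) F" by (auto simp: C_def elim: eventually_mono)
  next
    fix a assume "Sup C < a"
    then have "a \<notin> C" using cSup_upper[OF _ bdd] by force
    then show "eventually (\<lambda>t. h t < a) F" using dichotomy[of a] by (simp add: C_def not_less)
  qed
  then show ?thesis ..
qed

section \<open>Nearest sites and conflict points\<close>

lemma real2_eq_zeroI:
  fixes u v w :: "real ^ 2"
  assumes "u \<noteq> 0" "w \<noteq> 0" "u \<bullet> w = 0" "v \<bullet> u = 0" "v \<bullet> w = 0"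
  shows "v = 0"
proof -
  \<comment> \<open>The determinant of \<open>u\<close> and \<open>w\<close>. By Lagrange's identity
    and orthogonality its square is the product of the squared norms, and Cramer's rule then
    recovers \<open>v\<close> from its inner products with \<open>u\<close> and
    \<open>w\<close>.\<close>
  define d where "d = u $ 1 * w $ 2 - u $ 2 * w $ 1"
  have eqs: "u $ 1 * w $ 1 + u $ 2 * w $ 2 = 0" "v $ 1 * u $ 1 + v $ 2 * u $ 2 = 0"
    "v $ 1 * w $ 1 + v $ 2 * w $ 2 = 0"
    using assms by (simp_all add: inner_vec_def sum_2)
  have "d\<^sup>2 = (u \<bullet> u) * (w \<bullet> w) - (u \<bullet> w)\<^sup>2"
    by (simp add: d_def inner_vec_def sum_2 power2_eq_square algebra_simps)
  then have "d \<noteq> 0" using assms by auto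
  moreover have "d * v $ 1 = w $ 2 * (v $ 1 * u $ 1 + v $ 2 * u $ 2) - u $ 2 * (v $ 1 * w $ 1 + v $ 2 * w $ 2)"
    "d * v $ 2 = u $ 1 * (v $ 1 * w $ 1 + v $ 2 * w $ 2) - w $ 1 * (v $ 1 * u $ 1 + v $ 2 * u $ 2)"
    by (simp_all add: d_def algebra_simps)
  ultimately have "v $ 1 = 0" "v $ 2 = 0" using eqs by auto
  then show ?thesis by (simp add: vec_eq_iff forall_2)
qed

text \<open>All three points lie on one line orthogonal to \<open>u\<close>, so
  \<open>c = a + l *\<^sub>R (b - a)\<close> for some \<open>l\<close>. Equality of norms is then a
  quadratic equation in \<open>l\<close> with the roots 0 and 1.\<close>

lemma circle_line_inter_le_2:
  fixes u a b c :: "real ^ 2"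
  assumes "u \<noteq> 0" "norm b = norm a" "norm c = norm a" "u \<bullet> b = u \<bullet> a" "u \<bullet> c = u \<bullet> a"
    and "a \<noteq> b"
  shows "c = a \<or> c = b"
proof -
  define w where "w = b - a"
  define l where "l = ((c - a) \<bullet> w) / (w \<bullet> w)"
  have w: "w \<noteq> 0" "u \<bullet> w = 0" using assms by (simp_all add: w_def inner_diff_right)
  have "c - a - l *\<^sub>R w = 0"
  proof (rule real2_eq_zeroI[OF assms(1) w(1) w(2)])
    show "(c - a - l *\<^sub>R w) \<bullet> u = 0"
      using w assms by (simp add: inner_diff_right inner_commute[of _ u])
    show "(c - a - l *\<^sub>R w) \<bullet> w = 0"
      using w by (simp add: inner_diff_left l_def)
  qed
  then have c: "c = a + l *\<^sub>R w" by (simp add: algebra_simps)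
  have "c \<bullet> c = a \<bullet> a" "b \<bullet> b = a \<bullet> a" using assms by (simp_all add: dot_square_norm)
  then have "l * (2 * (a \<bullet> w) + l * (w \<bullet> w)) = 0" "2 * (a \<bullet> w) = - (w \<bullet> w)"
    by (simp_all add: c w_def algebra_simps inner_add_left inner_add_right inner_diff_left
      inner_diff_right inner_commute power2_eq_square)
  then have "l * (l - 1) * (w \<bullet> w) = 0" by (simp add: algebra_simps)
  then have "l = 0 \<or> l = 1" using w by simp
  then show ?thesis by (auto simp: c w_def)
qed

text \<open>When the squared inequalities are added, all squared norms cancel and twice the inner
  product remains.\<close>

lemma nearest_points_monotone:
  fixes x x' p p' :: "'a::real_inner"
  assumes "dist x p \<le> dist x p'" "dist x' p' \<le> dist x' p"
  shows "0 \<le> (x' - x) \<bullet> (p' - p)"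
proof -
  have "(dist x p)\<^sup>2 + (dist x' p')\<^sup>2 \<le> (dist x p')\<^sup>2 + (dist x' p)\<^sup>2"
    using assms by (intro add_mono power_mono) auto
  then show ?thesis
    by (simp add: dist_norm power2_norm_eq_inner inner_diff_left inner_diff_right inner_commute algebra_simps)
qed

text \<open>To first order in \<open>t\<close>, the distance from \<open>y + t v\<close> to \<open>r\<close> is that from \<open>y\<close> minus \<open>t v \<bullet> (r - y) / |r - y|\<close>.\<close>

lemma nearest_points_limit:
  fixes y u :: "'a::real_inner" and t :: "nat \<Rightarrow> real"
  assumes "closed U" and t: "\<And>n. 0 < t n" "t \<longlonglongrightarrow> 0" and v: "v \<longlonglongrightarrow> u"
    and p: "\<And>n. p n \<in> U" "\<And>n r. r \<in> U \<Longrightarrow> dist (y + t n *\<^sub>R v n) (p n) \<le> dist (y + t n *\<^sub>R v n) r"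
    and lim: "p \<longlonglongrightarrow> p0"
  shows "p0 \<in> U"
    and "\<And>r. r \<in> U \<Longrightarrow> dist y p0 \<le> dist y r"
    and "\<And>r. r \<in> U \<Longrightarrow> dist y r = dist y p0 \<Longrightarrow> u \<bullet> (r - y) \<le> u \<bullet> (p0 - y)"
proof -
  show "p0 \<in> U" using closed_sequentially[OF \<open>closed U\<close>] p(1) lim by blast
  have x: "(\<lambda>n. y + t n *\<^sub>R v n) \<longlonglongrightarrow> y"
    using tendsto_add[OF tendsto_const[of y] tendsto_scaleR[OF t(2) v]] by simp
  show nearest: "dist y p0 \<le> dist y r" if "r \<in> U" for r
    using p(2)[OF that] by (intro LIMSEQ_le[OF tendsto_dist[OF x lim] tendsto_dist[OF x tendsto_const]]) auto
  fix r assume r: "r \<in> U" "dist y r = dist y p0"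
  have "v n \<bullet> (r - y) \<le> v n \<bullet> (p n - y)" for n
  proof -
    \<comment> \<open>The quadratic term in \<open>t n\<close> does not depend on \<open>z\<close>,
      so it cancels when two sites are compared and no error term is left.\<close>
    have expand: "(dist (y + t n *\<^sub>R v n) z)\<^sup>2
        = (t n)\<^sup>2 * (v n \<bullet> v n) - t n * (2 * (v n \<bullet> (z - y))) + (dist y z)\<^sup>2" for z
      by (simp add: dist_norm power2_norm_eq_inner inner_diff_left inner_diff_right inner_add_left
        inner_add_right inner_commute algebra_simps power2_eq_square[of "t n"])
    have "(dist (y + t n *\<^sub>R v n) (p n))\<^sup>2 \<le> (dist (y + t n *\<^sub>R v n) r)\<^sup>2"
      using p(2)[OF r(1)] by (intro power_mono) auto
    moreover have "(dist y r)\<^sup>2 \<le> (dist y (p n))\<^sup>2"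
      unfolding r(2) using nearest[OF p(1)] by (intro power_mono) auto
    ultimately have "t n * (2 * (v n \<bullet> (r - y))) \<le> t n * (2 * (v n \<bullet> (p n - y)))"
      unfolding expand by linarith
    then show ?thesis using t(1)[of n] by simp
  qed
  then show "u \<bullet> (r - y) \<le> u \<bullet> (p0 - y)"
    by (intro LIMSEQ_le[OF tendsto_inner[OF v tendsto_const] tendsto_inner[OF v tendsto_diff[OF lim tendsto_const]]]) auto
qed

section \<open>Nearest sites, territories and the conflict set\<close>

locale disjoint_closed_family =
  fixes k :: nat and X :: "nat \<Rightarrow> (real ^ 2) set"
  assumes nonempty: "\<And>i. i \<in> {1..k} \<Longrightarrow> X i \<noteq> {}"
    and closed: "\<And>i. i \<in> {1..k} \<Longrightarrow> closed (X i)"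
    and disjoint: "\<And>i j. i \<in> {1..k} \<Longrightarrow> j \<in> {1..k} \<Longrightarrow> i \<noteq> j \<Longrightarrow> X i \<inter> X j = {}"
begin

definition sites :: "(real ^ 2) set" where
  "sites = (\<Union>i\<in>{1..k}. X i)"

definition nearest :: "real ^ 2 \<Rightarrow> real ^ 2 \<Rightarrow> bool" where
  "nearest x p \<longleftrightarrow> p \<in> sites \<and> (\<forall>r\<in>sites. dist x p \<le> dist x r)"

lemma closed_sites: "closed sites"
  unfolding sites_def using closed by blast

text \<open>The sets are closed and nonempty, so infima of distances are attained. This allows
  arguing with actual nearest points of the whole union instead of distance functions.\<close>

lemma Ter_iff_nearest:
  assumes "i \<in> {1..k}"
  shows "x \<in> Ter k X i \<longleftrightarrow> (\<exists>p\<in>X i. nearest x p)"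
proof
  assume x: "x \<in> Ter k X i"
  obtain p where p: "p \<in> X i" "infdist x (X i) = dist x p"
    using infdist_attains_inf[OF closed nonempty] assms by blast
  have "dist x p \<le> dist x r" if "r \<in> X j" "j \<in> {1..k}" for r j
  proof -
    have "infdist x (X i) \<le> infdist x (X j)" using x that(2) by (simp add: Ter_def)
    then show ?thesis using infdist_le[OF that(1), of x] p by simp
  qed
  then have "nearest x p" using p assms unfolding nearest_def sites_def by blast
  then show "\<exists>p\<in>X i. nearest x p" using p by blast
next
  assume "\<exists>p\<in>X i. nearest x p"
  then obtain p where p: "p \<in> X i" "nearest x p" by blast
  have "infdist x (X i) \<le> infdist x (X j)" if j: "j \<in> {1..k}" for j
  proof -
    obtain r where r: "r \<in> X j" "infdist x (X j) = dist x r"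
      using infdist_attains_inf[OF closed nonempty] j by blast
    have "dist x p \<le> dist x r" using p r j by (auto simp: nearest_def sites_def)
    then show ?thesis using infdist_le[OF p(1), of x] r by simp
  qed
  then show "x \<in> Ter k X i" by (simp add: Ter_def)
qed

lemma Conf_iff_nearest:
  "x \<in> Conf k X \<longleftrightarrow>
    (\<exists>i\<in>{1..k}. \<exists>j\<in>{1..k}. i \<noteq> j \<and> (\<exists>p\<in>X i. nearest x p) \<and> (\<exists>q\<in>X j. nearest x q))"
  unfolding Conf_def using Ter_iff_nearest by (auto simp del: atLeastAtMost_iff)

lemma closed_Ter: "closed (Ter k X i)"
proof -
  have "Ter k X i = (\<Inter>j\<in>{1..k}. {x. infdist x (X i) \<le> infdist x (X j)})" by (auto simp: Ter_def)
  then show ?thesis by (auto intro!: closed_INT closed_Collect_le continuous_intros)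
qed

lemma closed_Conf: "closed (Conf k X)"
proof -
  have "Conf k X = (\<Union>i\<in>{1..k}. \<Union>j\<in>{1..k} - {i}. Ter k X i \<inter> Ter k X j)" by (auto simp: Conf_def)
  then show ?thesis by (simp only:) (intro closed_UN closed_Int closed_Ter ballI; simp)
qed

text \<open>The indices \<open>i\<close> and \<open>j\<close> may vary with \<open>n\<close>. A
  common limit would lie in a single \<open>X l\<close> and have a neighbourhood missing the other
  sets, since these are finitely many and closed; eventually both points would be confined to
  \<open>X l\<close>.\<close>

lemma limits_of_distinct_sites_distinct:
  assumes "\<And>n. \<exists>i\<in>{1..k}. \<exists>j\<in>{1..k}. i \<noteq> j \<and> p n \<in> X i \<and> q n \<in> X j"
    and "p \<longlonglongrightarrow> p0" "q \<longlonglongrightarrow> q0"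
  shows "p0 \<noteq> q0"
proof
  assume eq: "p0 = q0"
  have "p0 \<in> sites"
    by (rule closed_sequentially[OF closed_sites _ assms(2)]) (use assms(1) in \<open>fastforce simp: sites_def\<close>)
  then obtain l where l: "l \<in> {1..k}" "p0 \<in> X l" by (auto simp: sites_def)
  define V where "V = - (\<Union>m\<in>{1..k} - {l}. X m)"
  have "closed (\<Union>m\<in>{1..k} - {l}. X m)" using closed by (intro closed_UN) auto
  then have "open V" unfolding V_def by (rule open_Compl)
  moreover have "p0 \<in> V" using disjoint[OF l(1)] l by (fastforce simp: V_def)
  ultimately have "eventually (\<lambda>n. p n \<in> V) sequentially" "eventually (\<lambda>n. q n \<in> V) sequentially"
    using assms(2,3) eq by (auto dest: topological_tendstoD)
  then have "eventually (\<lambda>n. False) sequentially"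
  proof eventually_elim
    case (elim n)
    then show ?case using assms(1)[of n] by (auto simp: V_def)
  qed
  then show False by simp
qed

text \<open>
  Let \<open>x, x'\<close> be conflict points at equal small distance from \<open>y0\<close> and in directions close to \<open>u\<close>. Their
  nearest sites are close to the points of the circle around \<open>y0\<close> that are extremal in direction
  \<open>u\<close>; there are two of these, \<open>p\<close> and \<open>q\<close>, and \<open>q - p\<close> is orthogonal to \<open>u\<close>, hence nearly parallel
  to \<open>x' - x\<close>. This contradicts the monotonicity of nearest point maps, applied to \<open>p, q\<close> and
  to \<open>q, p\<close>.
\<close>

lemma Conf_unique_in_cone:
  assumes u: "norm u = 1"
  shows "\<exists>\<delta>>0. \<forall>t x x'. x \<in> Conf k X \<and> x' \<in> Conf k X \<and> t \<le> \<delta> \<and> dist y0 x = t \<and> dist y0 x' = t \<and>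
    norm (x - y0 - t *\<^sub>R u) \<le> \<delta> * t \<and> norm (x' - y0 - t *\<^sub>R u) \<le> \<delta> * t \<longrightarrow> x = x'"
proof (rule ccontr)
  assume neg: "\<not> ?thesis"
  \<comment> \<open>If no constant works, these shrinking ones yield a sequence of pairs of distinct
    conflict points converging to \<open>y0\<close> in direction \<open>u\<close>.\<close>
  define \<delta> where "\<delta> n = 1 / (real n + 1)" for n
  have \<delta>: "\<delta> n > 0" "\<delta> n \<le> 1" "\<delta> \<longlonglongrightarrow> 0" for n
  proof -
    show "\<delta> \<longlonglongrightarrow> 0"
      using LIMSEQ_inverse_real_of_nat unfolding \<delta>_def by (simp add: inverse_eq_divide add.commute)
  qed (simp_all add: \<delta>_def)
  have "\<forall>n. \<exists>t x x'. x \<in> Conf k X \<and> x' \<in> Conf k X \<and> t \<le> \<delta> n \<and> dist y0 x = t \<and> dist y0 x' = t \<and>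
    norm (x - y0 - t *\<^sub>R u) \<le> \<delta> n * t \<and> norm (x' - y0 - t *\<^sub>R u) \<le> \<delta> n * t \<and> x \<noteq> x'"
    using neg \<delta>(1) by meson
  then obtain t x x' where Conf: "\<And>n. x n \<in> Conf k X" "\<And>n. x' n \<in> Conf k X"
    and t: "\<And>n. t n \<le> \<delta> n" and dist: "\<And>n. dist y0 (x n) = t n" "\<And>n. dist y0 (x' n) = t n"
    and cone: "\<And>n. norm (x n - y0 - t n *\<^sub>R u) \<le> \<delta> n * t n" "\<And>n. norm (x' n - y0 - t n *\<^sub>R u) \<le> \<delta> n * t n"
    and neq: "\<And>n. x n \<noteq> x' n"
    by metis
  \<comment> \<open>At radius 0 both points would be \<open>y0\<close>.\<close>
  have t_pos: "t n > 0" for n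
    using dist[of n] neq[of n] by (metis dist_eq_0_iff zero_less_dist_iff)
  have t_lim: "t \<longlonglongrightarrow> 0"
    by (rule tendsto_sandwich[OF _ _ tendsto_const \<delta>(3)]) (auto intro!: always_eventually less_imp_le t t_pos)
  define v where "v n = (x n - y0) /\<^sub>R t n" for n
  define v' where "v' n = (x' n - y0) /\<^sub>R t n" for n
  have x: "x n = y0 + t n *\<^sub>R v n" "x' n = y0 + t n *\<^sub>R v' n" for n
    using t_pos[of n] by (simp_all add: v_def v'_def)
  have norm_v: "norm (v n) = 1" "norm (v' n) = 1" for n
    using dist[of n] t_pos[of n] by (simp_all add: v_def v'_def dist_norm norm_minus_commute)
  have direction: "a \<longlonglongrightarrow> u" if "\<And>n. norm (t n *\<^sub>R a n - t n *\<^sub>R u) \<le> \<delta> n * t n" for a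
  proof -
    have "norm (a n - u) \<le> \<delta> n" for n
      using that[of n] t_pos[of n] by (simp flip: scaleR_diff_right add: mult.commute)
    then show ?thesis
      by (intro LIM_zero_cancel[OF Lim_null_comparison[OF _ \<delta>(3)]]) auto
  qed
  have v: "v \<longlonglongrightarrow> u" using cone(1) by (intro direction) (simp add: x)
  have v': "v' \<longlonglongrightarrow> u" using cone(2) by (intro direction) (simp add: x)
  \<comment> \<open>The chord direction is orthogonal to \<open>v n + v' n\<close>, because both
    points lie on one circle around \<open>y0\<close>; in the limit it becomes orthogonal to
    \<open>u\<close>.\<close>
  define w where "w n = (x' n - x n) /\<^sub>R norm (x' n - x n)" for n
  have w: "norm (w n) = 1" "w n \<bullet> (v n + v' n) = 0" for n
  proof -
    show "norm (w n) = 1" using neq[of n] by (simp add: w_def)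
    have "(v' n - v n) \<bullet> (v n + v' n) = (norm (v' n))\<^sup>2 - (norm (v n))\<^sup>2"
      by (simp add: power2_norm_eq_inner inner_diff_left inner_add_right inner_commute[of "v n" "v' n"])
    then have "(x' n - x n) \<bullet> (v n + v' n) = 0"
      using norm_v by (simp add: x flip: scaleR_diff_right)
    then show "w n \<bullet> (v n + v' n) = 0" by (simp add: w_def)
  qed
  let ?sep = "\<lambda>p q. \<exists>i\<in>{1..k}. \<exists>j\<in>{1..k}. i \<noteq> j \<and> p \<in> X i \<and> q \<in> X j"
  have "\<forall>z\<in>Conf k X. \<exists>pq. nearest z (fst pq) \<and> nearest z (snd pq) \<and> ?sep (fst pq) (snd pq)"
  proof
    fix z assume "z \<in> Conf k X"
    then obtain p q where "nearest z p" "nearest z q" "?sep p q"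
      unfolding Conf_iff_nearest by blast
    then show "\<exists>pq. nearest z (fst pq) \<and> nearest z (snd pq) \<and> ?sep (fst pq) (snd pq)"
      by (intro exI[of _ "(p, q)"]) simp
  qed
  from bchoice[OF this] obtain f where f: "\<And>z. z \<in> Conf k X \<Longrightarrow>
      nearest z (fst (f z)) \<and> nearest z (snd (f z)) \<and> ?sep (fst (f z)) (snd (f z))"
    by blast
  define p q p' q' where "p n = fst (f (x n))" and "q n = snd (f (x n))"
    and "p' n = fst (f (x' n))" and "q' n = snd (f (x' n))" for n
  have near: "nearest (x n) (p n)" "nearest (x n) (q n)" "nearest (x' n) (p' n)" "nearest (x' n) (q' n)"
    and sep: "?sep (p n) (q n)" "?sep (p' n) (q' n)" for n
    using f[OF Conf(1)[of n]] f[OF Conf(2)[of n]] by (simp_all only: p_def q_def p'_def q'_def)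
  obtain r where r: "r \<in> sites" using near(1)[of 0] by (auto simp: nearest_def)
  \<comment> \<open>Comparison with a fixed site \<open>r\<close> bounds the distance from
    \<open>y0\<close> to a nearest site by \<open>2 * t n + dist y0 r\<close>, and
    \<open>t n \<le> 1\<close>.\<close>
  define B where "B = cball y0 (2 + dist y0 r)"
  have bounded: "s \<in> B" if "dist y0 z = t n" "nearest z s" for z s n
  proof -
    have "dist y0 s \<le> t n + dist z s" using dist_triangle[of y0 s z] that by simp
    moreover have "dist z s \<le> dist z r" using that r by (auto simp: nearest_def)
    moreover have "dist z r \<le> t n + dist y0 r" using dist_triangle[of z r y0] that by (simp add: dist_commute)
    ultimately show ?thesis using t[of n] \<delta>(2)[of n] by (simp add: B_def)
  qed
  \<comment> \<open>One compact product for all five sequences gives a common convergent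
    subsequence.\<close>
  define K where "K = B \<times> B \<times> B \<times> B \<times> sphere (0 :: real ^ 2) 1"
  define g where "g n = (p n, q n, p' n, q' n, w n)" for n
  have "compact K" unfolding K_def B_def by (intro compact_Times) auto
  moreover have "\<forall>n. g n \<in> K"
    using bounded[OF dist(1) near(1)] bounded[OF dist(1) near(2)] bounded[OF dist(2) near(3)]
      bounded[OF dist(2) near(4)] w(1) by (simp add: g_def K_def)
  ultimately obtain l \<phi> where \<phi>: "strict_mono \<phi>" and L: "(g \<circ> \<phi>) \<longlonglongrightarrow> l"
    unfolding compact_def by metis
  obtain p0 q0 p1 q1 w0 where l: "l = (p0, q0, p1, q1, w0)" by (cases l) auto
  have lim: "(p \<circ> \<phi>) \<longlonglongrightarrow> p0" "(q \<circ> \<phi>) \<longlonglongrightarrow> q0" "(p' \<circ> \<phi>) \<longlonglongrightarrow> p1" "(q' \<circ> \<phi>) \<longlonglongrightarrow> q1"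
    "(w \<circ> \<phi>) \<longlonglongrightarrow> w0"
    using tendsto_fst[OF L] tendsto_fst[OF tendsto_snd[OF L]]
      tendsto_fst[OF tendsto_snd[OF tendsto_snd[OF L]]]
      tendsto_fst[OF tendsto_snd[OF tendsto_snd[OF tendsto_snd[OF L]]]]
      tendsto_snd[OF tendsto_snd[OF tendsto_snd[OF tendsto_snd[OF L]]]]
    by (simp_all add: l g_def comp_def)
  note sub = LIMSEQ_subseq_LIMSEQ[OF _ \<phi>]
  have extremal: "s0 \<in> sites \<and> (\<forall>r\<in>sites. dist y0 s0 \<le> dist y0 r) \<and>
      (\<forall>r\<in>sites. dist y0 r = dist y0 s0 \<longrightarrow> u \<bullet> (r - y0) \<le> u \<bullet> (s0 - y0))"
    if "a \<longlonglongrightarrow> u" "(s \<circ> \<phi>) \<longlonglongrightarrow> s0" "\<And>n. nearest (y0 + t n *\<^sub>R a n) (s n)" for a s s0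
    using nearest_points_limit[OF closed_sites _ sub[OF t_lim] sub[OF that(1)] _ _ that(2), of y0]
      t_pos that(3) by (auto simp: nearest_def)
  have E: "s0 \<in> sites \<and> (\<forall>r\<in>sites. dist y0 s0 \<le> dist y0 r) \<and>
      (\<forall>r\<in>sites. dist y0 r = dist y0 s0 \<longrightarrow> u \<bullet> (r - y0) \<le> u \<bullet> (s0 - y0))"
    if "s0 \<in> {p0, q0, p1, q1}" for s0
    using that extremal[OF v lim(1)] extremal[OF v lim(2)] extremal[OF v' lim(3)] extremal[OF v' lim(4)]
      near unfolding x by blast
  have same: "dist y0 s = dist y0 s' \<and> u \<bullet> (s - y0) = u \<bullet> (s' - y0)"
    if "s \<in> {p0, q0, p1, q1}" "s' \<in> {p0, q0, p1, q1}" for s s'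
    using E[OF that(1)] E[OF that(2)] by (metis order_antisym)
  have "p0 \<noteq> q0" "p1 \<noteq> q1"
    using limits_of_distinct_sites_distinct[OF _ lim(1,2)] limits_of_distinct_sites_distinct[OF _ lim(3,4)] sep
    by (auto simp: comp_def)
  have "s = p0 \<or> s = q0" if "s \<in> {p1, q1}" for s
  proof -
    have "s - y0 = p0 - y0 \<or> s - y0 = q0 - y0"
    proof (rule circle_line_inter_le_2)
      show "u \<noteq> 0" using u by auto
    qed (use same[of p0 q0] same[of p0 s] that \<open>p0 \<noteq> q0\<close> in \<open>auto simp: dist_norm norm_minus_commute\<close>)
    then show ?thesis by simp
  qed
  \<comment> \<open>The sites chosen for \<open>x n\<close> and for \<open>x' n\<close> are
    unrelated, so their limits may come in either order.\<close>
  then consider "p1 = p0" "q1 = q0" | "p1 = q0" "q1 = p0" using \<open>p1 \<noteq> q1\<close> by blast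
  moreover have mono: "0 \<le> w0 \<bullet> (s1 - s0)"
    if "(s \<circ> \<phi>) \<longlonglongrightarrow> s0" "(s' \<circ> \<phi>) \<longlonglongrightarrow> s1" "\<And>n. nearest (x n) (s n)" "\<And>n. nearest (x' n) (s' n)" for s s' s0 s1
  proof -
    have "0 \<le> (x' n - x n) \<bullet> (s' n - s n)" for n
      using that(3,4)[of n] by (intro nearest_points_monotone) (auto simp: nearest_def)
    then have "0 \<le> w n \<bullet> (s' n - s n)" for n by (simp add: w_def)
    then have "\<forall>n. 0 \<le> (w \<circ> \<phi>) n \<bullet> ((s' \<circ> \<phi>) n - (s \<circ> \<phi>) n)" by simp
    then show ?thesis
      by (intro LIMSEQ_le_const[OF tendsto_inner[OF lim(5) tendsto_diff[OF that(2,1)]]]) auto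
  qed
  \<comment> \<open>In either order, a sequence tending to \<open>p0\<close> for one conflict point
    is compared with a sequence tending to \<open>q0\<close> for the other, and vice versa;
    monotonicity gives both signs.\<close>
  ultimately have "0 \<le> w0 \<bullet> (q0 - p0)" "0 \<le> w0 \<bullet> (p0 - q0)"
    using mono[OF lim(1) lim(4) near(1) near(4)] mono[OF lim(2) lim(3) near(2) near(3)]
      mono[OF lim(1) lim(3) near(1) near(3)] mono[OF lim(2) lim(4) near(2) near(4)]
    by (metis)+
  then have "(q0 - p0) \<bullet> w0 = 0" by (simp add: inner_diff_right inner_commute)
  moreover have "(q0 - p0) \<bullet> u = 0"
    using same[of p0 q0] by (simp add: inner_diff_right inner_diff_left inner_commute)
  moreover have "u \<bullet> w0 = 0"
  proof -
    have "(\<lambda>n. (w \<circ> \<phi>) n \<bullet> ((v \<circ> \<phi>) n + (v' \<circ> \<phi>) n)) \<longlonglongrightarrow> w0 \<bullet> (u + u)"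
      by (intro tendsto_inner tendsto_add lim sub v v')
    then have "w0 \<bullet> (u + u) = 0" using w(2) by (simp add: comp_def LIMSEQ_const_iff)
    then show ?thesis unfolding inner_add_right by (simp add: inner_commute)
  qed
  moreover have "w0 \<noteq> 0"
    using tendsto_norm[OF lim(5)] w(1) by (auto simp: comp_def LIMSEQ_const_iff)
  moreover have "u \<noteq> 0" using u by auto
  ultimately have "q0 - p0 = 0" using real2_eq_zeroI by blast
  with \<open>p0 \<noteq> q0\<close> show False by simp
qed

text \<open>Moving from \<open>y0\<close> towards one of its nearest sites keeps that site nearest.
  So a punctured disc meets both the territory of \<open>i\<close> and the union of the other
  territories; both are closed and they cover the disc, so by connectedness they meet in it.\<close>

lemma Conf_accumulates:
  assumes y0: "y0 \<in> Conf k X" and "\<rho> > 0"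
  shows "\<exists>x\<in>Conf k X. x \<noteq> y0 \<and> dist y0 x < \<rho>"
proof -
  obtain i j p q where ij: "i \<in> {1..k}" "j \<in> {1..k}" "i \<noteq> j" and pq: "p \<in> X i" "q \<in> X j"
    and near: "nearest y0 p" "nearest y0 q"
    using y0 unfolding Conf_iff_nearest by blast
  have "p \<noteq> q" using disjoint ij pq by blast
  have "dist y0 p = dist y0 q"
    using near by (auto simp: nearest_def intro: order_antisym)
  \<comment> \<open>If the common distance were 0, both sites would be \<open>y0\<close>; hence
    there is room to move towards each of them.\<close>
  then have pos: "dist y0 p > 0" "dist y0 q > 0" using \<open>p \<noteq> q\<close> by auto
  have step: "\<exists>z\<in>ball y0 \<rho> - {y0}. nearest z s" if s: "nearest y0 s" "dist y0 s > 0" for s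
  proof -
    \<comment> \<open>Keeps \<open>z\<close> on the segment from \<open>y0\<close> to
      \<open>s\<close> and within distance \<open>\<rho>\<close> of \<open>y0\<close>.\<close>
    define c where "c = min (1 / 2) (\<rho> / (2 * dist y0 s))"
    have c: "0 < c" "c \<le> 1" "c * dist y0 s < \<rho>"
    proof -
      show "0 < c" "c \<le> 1" using s \<open>\<rho> > 0\<close> by (auto simp: c_def)
      have "c * dist y0 s \<le> \<rho> / (2 * dist y0 s) * dist y0 s"
        by (intro mult_right_mono) (auto simp: c_def)
      then show "c * dist y0 s < \<rho>" using s \<open>\<rho> > 0\<close> by simp
    qed
    define z where "z = y0 + c *\<^sub>R (s - y0)"
    have y0z: "dist y0 z = c * dist y0 s"
      using c by (simp add: z_def dist_norm norm_minus_commute)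
    moreover have zs: "dist z s = (1 - c) * dist y0 s"
    proof -
      have "z - s = (1 - c) *\<^sub>R (y0 - s)" by (simp add: z_def algebra_simps)
      then show ?thesis using c by (simp add: dist_norm)
    qed
    moreover have "dist z s \<le> dist z r" if "r \<in> sites" for r
    proof -
      have "dist y0 s \<le> dist y0 r" using s that by (simp add: nearest_def)
      also have "\<dots> \<le> dist y0 z + dist z r" by (rule dist_triangle)
      finally show ?thesis using y0z zs by (simp add: algebra_simps)
    qed
    ultimately show ?thesis
      using s c by (intro bexI[of _ z]) (auto simp: nearest_def)
  qed
  obtain z where z: "z \<in> ball y0 \<rho> - {y0}" "nearest z p" using step near pos by blast
  obtain z' where z': "z' \<in> ball y0 \<rho> - {y0}" "nearest z' q" using step near pos by blast
  define L where "L = (\<Union>l\<in>{1..k} - {i}. Ter k X l)"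
  have "connected (ball y0 \<rho> - {y0})" by (rule connected_punctured_ball) simp
  moreover have "closed L" unfolding L_def by (intro closed_UN ballI closed_Ter) auto
  moreover have "ball y0 \<rho> - {y0} \<subseteq> Ter k X i \<union> L"
  proof
    fix x assume "x \<in> ball y0 \<rho> - {y0}"
    have "\<exists>s. nearest x s"
    proof -
      have "sites \<noteq> {}" using near by (auto simp: nearest_def)
      then obtain s where "s \<in> sites" "infdist x sites = dist x s"
        using infdist_attains_inf[OF closed_sites] by blast
      then show ?thesis using infdist_le by (metis nearest_def)
    qed
    then obtain s l where "nearest x s" "l \<in> {1..k}" "s \<in> X l" unfolding nearest_def sites_def by blast
    then have "x \<in> Ter k X l" "l \<in> {1..k}" using Ter_iff_nearest by blast+
    then show "x \<in> Ter k X i \<union> L" by (auto simp: L_def)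
  qed
  moreover have "z \<in> Ter k X i" "z' \<in> L"
    using z z' pq ij Ter_iff_nearest unfolding L_def by blast+
  ultimately obtain x where x: "x \<in> ball y0 \<rho> - {y0}" "x \<in> Ter k X i" "x \<in> L"
    using closed_Ter[of i] z z' unfolding connected_closed by blast
  then obtain l where "l \<in> {1..k}" "i \<noteq> l" "x \<in> Ter k X l" unfolding L_def by blast
  then have "x \<in> Conf k X" using ij x unfolding Conf_def by blast
  then show ?thesis using x by auto
qed

end

section \<open>Arcs of the conflict set\<close>

text \<open>Squaring removes the roots and leaves polynomials, which are definable terms.\<close>

lemma dist_real2_le_iff:
  fixes a b c d :: "real ^ 2"
  shows "dist a b \<le> dist c d \<longleftrightarrow>
    (a $ 1 - b $ 1)\<^sup>2 + (a $ 2 - b $ 2)\<^sup>2 \<le> (c $ 1 - d $ 1)\<^sup>2 + (c $ 2 - d $ 2)\<^sup>2"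
  by (simp add: dist_norm norm_eq_sqrt_inner inner_vec_def sum_2 power2_eq_square)

locale definable_family = o_minimal_field_expansion S + disjoint_closed_family k X
  for S k X +
  assumes definable_sites: "\<And>i. i \<in> {1..k} \<Longrightarrow> definable_set S (X i)"
begin

lemma definable_Conf: "definable (\<lambda>e. vector [e i, e j] \<in> Conf k X)"
proof -
  have near: "nearest x p \<longleftrightarrow> (\<exists>i\<in>{1..k}. p \<in> X i) \<and>
      (\<forall>r. (\<exists>i\<in>{1..k}. r \<in> X i) \<longrightarrow> dist x p \<le> dist x r)" for x p
    unfolding nearest_def sites_def by blast
  show ?thesis
    unfolding Conf_iff_nearest Bex_def[of "X _"] near dist_real2_le_iff
    by (intro definable_Bex definable_intros definable_set_in definable_sites finite_atLeastAtMost;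
        simp only: vector_2; (intro definable_Bex definable_intros definable_set_in definable_sites finite_atLeastAtMost)?)
qed

text \<open>Where \<open>x\<close> is unique for each \<open>t\<close>, this relation is the graph
  of a curve parametrized by its distance from \<open>y0\<close>. The distance condition forces
  \<open>0 \<le> t\<close>, and at \<open>t = 0\<close> it leaves only \<open>y0\<close>.\<close>

definition cone_rel :: "real ^ 2 \<Rightarrow> real ^ 2 \<Rightarrow> real \<Rightarrow> real \<Rightarrow> real ^ 2 \<Rightarrow> bool" where
  "cone_rel y0 u \<delta> t x \<longleftrightarrow> x \<in> Conf k X \<and> dist y0 x = t \<and> norm (x - y0 - t *\<^sub>R u) \<le> \<delta> * t"

text \<open>A polynomial form for the formula calculus; squaring loses signs, so
  \<open>0 \<le> t\<close> has to be recorded separately.\<close>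

lemma cone_rel_iff:
  assumes "\<delta> > 0"
  shows "cone_rel y0 u \<delta> t x \<longleftrightarrow> x \<in> Conf k X \<and> 0 \<le> t \<and>
    (x $ 1 - y0 $ 1)\<^sup>2 + (x $ 2 - y0 $ 2)\<^sup>2 = t\<^sup>2 \<and>
    (x $ 1 - y0 $ 1 - t * u $ 1)\<^sup>2 + (x $ 2 - y0 $ 2 - t * u $ 2)\<^sup>2 \<le> (\<delta> * t)\<^sup>2"
proof (cases "0 \<le> t")
  case True
  have norm2: "(norm z)\<^sup>2 = (z $ 1)\<^sup>2 + (z $ 2)\<^sup>2" for z :: "real ^ 2"
    unfolding power2_norm_eq_inner by (simp add: inner_vec_def sum_2 power2_eq_square)
  have "dist y0 x = t \<longleftrightarrow> (norm (x - y0))\<^sup>2 = t\<^sup>2"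
    using True by (simp add: dist_norm norm_minus_commute)
  moreover have "norm (x - y0 - t *\<^sub>R u) \<le> \<delta> * t \<longleftrightarrow> (norm (x - y0 - t *\<^sub>R u))\<^sup>2 \<le> (\<delta> * t)\<^sup>2"
    using True assms by (simp add: power_mono_iff)
  ultimately show ?thesis using True by (simp add: cone_rel_def norm2)
next
  case False
  then show ?thesis by (auto simp: cone_rel_def)
qed

lemma definable_cone_rel:
  assumes "\<delta> > 0"
  shows "definable (\<lambda>e. cone_rel y0 u \<delta> (e l) (vector [e i, e j]))"
  unfolding cone_rel_iff[OF assms] vector_2
  by (intro definable_intros definable_Conf)

text \<open>Continuity comes from a graph that is relatively closed, with values in a compact ball.
  The tangent exists because each coordinate of the unit direction is bounded and its comparison
  with any constant is eventually decided.\<close>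

lemma arc_in_cone:
  assumes y0: "y0 \<in> Conf k X" and \<delta>: "\<delta> > 0" "\<epsilon> > 0" and ex1: "\<And>t. 0 \<le> t \<Longrightarrow> t < \<epsilon> \<Longrightarrow> \<exists>!x. cone_rel y0 u \<delta> t x"
  defines "\<gamma> \<equiv> \<lambda>t. THE x. cone_rel y0 u \<delta> t x"
  shows "definable_arc S y0 \<epsilon> \<gamma>" "\<exists>v. norm v = 1 \<and> has_unit_tangent \<gamma> y0 v"
proof -
  have \<gamma>: "cone_rel y0 u \<delta> t x \<longleftrightarrow> x = \<gamma> t" if "0 \<le> t" "t < \<epsilon>" for t x
    using theI'[OF ex1[OF that]] ex1[OF that] unfolding \<gamma>_def by blast
  have norm_\<gamma>: "norm (\<gamma> t - y0) = t" if "0 \<le> t" "t < \<epsilon>" for t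
    using \<gamma>[OF that, of "\<gamma> t"] by (simp add: cone_rel_def dist_norm norm_minus_commute)
  have "continuous_on {0..<\<epsilon>} \<gamma>"
  proof -
    have "\<gamma> \<in> {0..<\<epsilon>} \<rightarrow> cball y0 \<epsilon>"
      using norm_\<gamma> by (auto simp: dist_norm norm_minus_commute)
    note graph_eq = continuous_closed_graph_eq[OF compact_cball this]
    have "(\<lambda>t. (t, \<gamma> t)) ` {0..<\<epsilon>} = ({0..<\<epsilon>} \<times> cball y0 \<epsilon>) \<inter> {(t, x). cone_rel y0 u \<delta> t x}"
      using \<gamma> norm_\<gamma> by (auto simp: dist_norm norm_minus_commute)
    moreover have "closed {(t, x). cone_rel y0 u \<delta> t x}"
    proof -
      have "{(t, x). cone_rel y0 u \<delta> t x} = (UNIV \<times> Conf k X) \<inter> {z. dist y0 (snd z) = fst z}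
          \<inter> {z. norm (snd z - y0 - fst z *\<^sub>R u) \<le> \<delta> * fst z}"
        by (auto simp: cone_rel_def)
      then show ?thesis
        by (simp only:) (intro closed_Int closed_Times closed_UNIV closed_Conf closed_Collect_eq
          closed_Collect_le continuous_intros)
    qed
    ultimately show ?thesis
      unfolding graph_eq by (simp add: closedin_closed_Int)
  qed
  moreover have "definable_map_on S {0..<\<epsilon>} \<gamma>"
  proof -
    define P where "P e \<longleftrightarrow> 0 \<le> e 0 \<and> e 0 < \<epsilon> \<and> cone_rel y0 u \<delta> (e 0) (vector [e 1, e 2])"
      for e :: "nat \<Rightarrow> real"
    have "definable P"
      unfolding P_def by (intro definable_intros definable_cone_rel \<delta>)
    then have "{xs \<in> Rn 3. P (\<lambda>i. xs ! i)} \<in> S 3"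
      by (rule definable_imp_in) (simp add: P_def)
    also have "{xs \<in> Rn 3. P (\<lambda>i. xs ! i)} = {[t, \<gamma> t $ 1, \<gamma> t $ 2] | t. t \<in> {0..<\<epsilon>}}" (is "?L = ?R")
    proof
      show "?L \<subseteq> ?R"
      proof
        fix xs assume "xs \<in> ?L"
        then obtain t a b where xs: "xs = [t, a, b]" "P (\<lambda>i. [t, a, b] ! i)"
          by (auto simp: Rn_def numeral_3_eq_3 length_Suc_conv)
        then have t: "0 \<le> t" "t < \<epsilon>" and "cone_rel y0 u \<delta> t (vector [a, b])" by (auto simp: P_def)
        then have "vector [a, b] = \<gamma> t" using \<gamma> by blast
        then have "\<gamma> t $ 1 = a" "\<gamma> t $ 2 = b" by (auto simp flip: \<open>vector [a, b] = \<gamma> t\<close>)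
        with t xs show "xs \<in> ?R" by auto
      qed
      show "?R \<subseteq> ?L"
      proof
        fix xs assume "xs \<in> ?R"
        then obtain t where t: "0 \<le> t" "t < \<epsilon>" "xs = [t, \<gamma> t $ 1, \<gamma> t $ 2]" by auto
        have "vector [\<gamma> t $ 1, \<gamma> t $ 2] = \<gamma> t" by (simp add: vec_eq_iff forall_2)
        with t \<gamma> show "xs \<in> ?L" by (simp add: P_def Rn_def)
      qed
    qed
    finally show ?thesis unfolding definable_map_on_def .
  qed
  moreover have "\<gamma> 0 = y0" using norm_\<gamma>[of 0] \<open>\<epsilon> > 0\<close> by simp
  ultimately show "definable_arc S y0 \<epsilon> \<gamma>"
    using norm_\<gamma> \<open>\<epsilon> > 0\<close> by (simp add: definable_arc_def)

  have ev: "eventually (\<lambda>t. 0 < t \<and> t < \<epsilon>) (at_right 0)"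
    using \<open>\<epsilon> > 0\<close> by (auto simp: eventually_at_right_field)
  have limit: "\<exists>l. ((\<lambda>t. ((\<gamma> t - y0) /\<^sub>R norm (\<gamma> t - y0)) $ i) \<longlongrightarrow> l) (at_right 0)"
    if "definable_fun (\<lambda>e. vector [e 1, e 0] $ i)" for i :: 2
  proof (rule bounded_real_limit_exists[where B = 1])
    show "eventually (\<lambda>t. \<bar>((\<gamma> t - y0) /\<^sub>R norm (\<gamma> t - y0)) $ i\<bar> \<le> 1) (at_right 0)"
    proof (intro always_eventually allI)
      fix t
      have "\<bar>((\<gamma> t - y0) /\<^sub>R norm (\<gamma> t - y0)) $ i\<bar> \<le> norm ((\<gamma> t - y0) /\<^sub>R norm (\<gamma> t - y0))"
        by (rule component_le_norm_cart)
      \<comment> \<open>If \<open>\<gamma> t = y0\<close>, the quotient is 0 because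
        \<open>inverse 0 = 0\<close>.\<close>
      also have "\<dots> \<le> 1" by (cases "\<gamma> t = y0") simp_all
      finally show "\<bar>((\<gamma> t - y0) /\<^sub>R norm (\<gamma> t - y0)) $ i\<bar> \<le> 1" .
    qed
    fix c
    \<comment> \<open>A definable form of the comparison of the direction's coordinate with
      \<open>c\<close>, multiplied through by \<open>t\<close>; the two agree only for
      \<open>0 < t < \<epsilon>\<close>.\<close>
    define P where "P t \<longleftrightarrow> (\<exists>x. cone_rel y0 u \<delta> t x \<and> x $ i - y0 $ i < c * t)" for t
    have "definable (\<lambda>e. P (e 0))"
      unfolding P_def by (rule definable_ex_real2) (intro definable_intros definable_cone_rel \<delta> that)
    then have "eventually P (at_right 0) \<or> eventually (\<lambda>t. \<not> P t) (at_right 0)"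
      by (rule definable_eventually_at_right)
    moreover have eq: "eventually (\<lambda>t. P t \<longleftrightarrow> ((\<gamma> t - y0) /\<^sub>R norm (\<gamma> t - y0)) $ i < c) (at_right 0)"
      using ev
    proof eventually_elim
      case (elim t)
      then have "P t \<longleftrightarrow> \<gamma> t $ i - y0 $ i < c * t" using \<gamma> by (simp add: P_def)
      then show ?case using elim norm_\<gamma>[of t] by (simp add: field_simps)
    qed
    moreover from eq have not_eq:
      "eventually (\<lambda>t. (\<not> P t) = (\<not> ((\<gamma> t - y0) /\<^sub>R norm (\<gamma> t - y0)) $ i < c)) (at_right 0)"
      by (rule eventually_mono) simp
    ultimately show "eventually (\<lambda>t. ((\<gamma> t - y0) /\<^sub>R norm (\<gamma> t - y0)) $ i < c) (at_right 0) \<or>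
        eventually (\<lambda>t. \<not> ((\<gamma> t - y0) /\<^sub>R norm (\<gamma> t - y0)) $ i < c) (at_right 0)"
      unfolding eventually_subst[OF eq] eventually_subst[OF not_eq] by blast
  qed simp
  have "\<forall>i. \<exists>l. ((\<lambda>t. ((\<gamma> t - y0) /\<^sub>R norm (\<gamma> t - y0)) $ i) \<longlongrightarrow> l) (at_right 0)"
  proof
    fix i :: 2
    have "definable_fun (\<lambda>e. (vector [e 1, e 0] :: real ^ 2) $ i)"
      using exhaust_2[of i] by (rule disjE) (simp_all only: vector_2 definable_fun_var)
    then show "\<exists>l. ((\<lambda>t. ((\<gamma> t - y0) /\<^sub>R norm (\<gamma> t - y0)) $ i) \<longlongrightarrow> l) (at_right 0)"
      by (rule limit)
  qed
  from choice[OF this] obtain l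
    where l: "\<And>i. ((\<lambda>t. ((\<gamma> t - y0) /\<^sub>R norm (\<gamma> t - y0)) $ i) \<longlongrightarrow> l i) (at_right 0)"
    by blast
  have tangent: "has_unit_tangent \<gamma> y0 (\<chi> i. l i)"
    unfolding has_unit_tangent_def by (rule vec_tendstoI) (simp only: vec_lambda_beta l)
  have "((\<lambda>t. norm ((\<gamma> t - y0) /\<^sub>R norm (\<gamma> t - y0))) \<longlongrightarrow> 1) (at_right 0)"
  proof (rule tendsto_eventually)
    show "eventually (\<lambda>t. norm ((\<gamma> t - y0) /\<^sub>R norm (\<gamma> t - y0)) = 1) (at_right 0)"
      using ev
    proof eventually_elim
      case (elim t)
      then show ?case using norm_\<gamma>[of t] by simp
    qed
  qed
  moreover have "((\<lambda>t. norm ((\<gamma> t - y0) /\<^sub>R norm (\<gamma> t - y0))) \<longlongrightarrow> norm (\<chi> i. l i)) (at_right 0)"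
    by (rule tendsto_norm[OF tangent[unfolded has_unit_tangent_def]])
  ultimately have "norm (\<chi> i. l i) = 1"
    by (rule tendsto_unique[OF trivial_limit_at_right_real, symmetric])
  with tangent show "\<exists>v. norm v = 1 \<and> has_unit_tangent \<gamma> y0 v" by blast
qed

lemma Conf_germ_arcs:
  assumes y0: "y0 \<in> Conf k X"
  shows "\<exists>(s::nat) \<gamma> \<epsilon> u.
           (\<forall>i\<in>{1..s}. definable_arc S y0 (\<epsilon> i) (\<gamma> i) \<and> has_unit_tangent (\<gamma> i) y0 (u i)) \<and>
           (\<forall>i\<in>{1..s}. \<forall>j\<in>{1..s}. i \<noteq> j \<longrightarrow> u i \<noteq> u j) \<and>
           same_germ y0 (Conf k X) (\<Union>i\<in>{1..s}. \<gamma> i ` {0..<\<epsilon> i})"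
proof -
  have "\<forall>u\<in>sphere 0 1. \<exists>\<delta>>0. \<forall>t x x'. t \<le> \<delta> \<and> cone_rel y0 u \<delta> t x \<and> cone_rel y0 u \<delta> t x' \<longrightarrow> x = x'"
  proof
    fix u :: "real ^ 2" assume "u \<in> sphere 0 1"
    then have "norm u = 1" by simp
    from Conf_unique_in_cone[OF this, of y0] obtain \<delta> where "\<delta> > 0"
      "\<And>t x x'. x \<in> Conf k X \<and> x' \<in> Conf k X \<and> t \<le> \<delta> \<and> dist y0 x = t \<and> dist y0 x' = t \<and>
        norm (x - y0 - t *\<^sub>R u) \<le> \<delta> * t \<and> norm (x' - y0 - t *\<^sub>R u) \<le> \<delta> * t \<Longrightarrow> x = x'"
      by blast
    then show "\<exists>\<delta>>0. \<forall>t x x'. t \<le> \<delta> \<and> cone_rel y0 u \<delta> t x \<and> cone_rel y0 u \<delta> t x' \<longrightarrow> x = x'"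
      unfolding cone_rel_def by blast
  qed
  \<comment> \<open>A constant is fixed for every unit vector, not only for those of a finite cover,
    since uniqueness is used again in the cones around the tangents.\<close>
  from bchoice[OF this] obtain \<delta> where "\<forall>u\<in>sphere 0 1. \<delta> u > 0 \<and>
      (\<forall>t x x'. t \<le> \<delta> u \<and> cone_rel y0 u (\<delta> u) t x \<and> cone_rel y0 u (\<delta> u) t x' \<longrightarrow> x = x')"
    by blast
  then have \<delta>: "\<delta> u > 0"
    and unique: "t \<le> \<delta> u \<Longrightarrow> cone_rel y0 u (\<delta> u) t x \<Longrightarrow> cone_rel y0 u (\<delta> u) t x' \<Longrightarrow> x = x'"
    if "norm u = 1" for u t x x'
    using that unfolding Ball_def mem_sphere_0 by blast+
  have "sphere (0 :: real ^ 2) 1 \<subseteq> (\<Union>u\<in>sphere 0 1. ball u (\<delta> u))"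
    using \<delta> by fastforce
  then obtain F where F: "F \<subseteq> sphere 0 1" "finite F" "sphere 0 1 \<subseteq> (\<Union>u\<in>F. ball u (\<delta> u))"
    using compactE_image[OF compact_sphere[of "0 :: real ^ 2" 1], of "sphere 0 1" "\<lambda>u. ball u (\<delta> u)"]
    by (metis open_ball)
  define N where "N u t \<longleftrightarrow> (\<exists>x. cone_rel y0 u (\<delta> u) t x)" for u t
  define \<Gamma> where "\<Gamma> u = (\<lambda>t. THE x. cone_rel y0 u (\<delta> u) t x)" for u
  \<comment> \<open>The directions of the cover whose cones contain a conflict point at every small
    distance; in the other cones there is none at any small positive distance.\<close>
  define G where "G = {u \<in> F. eventually (N u) (at_right 0)}"
  have F_norm: "norm u = 1" if "u \<in> F" for u using F(1) that by auto
  have not_G: "eventually (\<lambda>t. \<not> N u t) (at_right 0)" if "u \<in> F - G" for u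
  proof -
    have "\<delta> u > 0" using \<delta> F_norm that by blast
    then have "definable (\<lambda>e. N u (e 0))"
      unfolding N_def by (intro definable_ex_real2 definable_cone_rel)
    then show ?thesis using definable_eventually_at_right[of "N u"] that by (auto simp: G_def)
  qed
  have "\<forall>u\<in>G. \<exists>\<epsilon>v. fst \<epsilon>v > 0 \<and> (\<forall>t. 0 \<le> t \<and> t < fst \<epsilon>v \<longrightarrow> (\<forall>x. cone_rel y0 u (\<delta> u) t x \<longleftrightarrow> x = \<Gamma> u t)) \<and>
      definable_arc S y0 (fst \<epsilon>v) (\<Gamma> u) \<and> norm (snd \<epsilon>v) = 1 \<and> has_unit_tangent (\<Gamma> u) y0 (snd \<epsilon>v)"
  proof
    fix u assume u: "u \<in> G"
    then have norm_u: "norm u = 1" and "eventually (N u) (at_right 0)" using F_norm by (auto simp: G_def)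
    then obtain b where b: "b > 0" "\<And>t. 0 < t \<Longrightarrow> t < b \<Longrightarrow> N u t"
      by (auto simp: eventually_at_right_field)
    \<comment> \<open>The bound \<open>b\<close> secures existence and \<open>\<delta> u\<close>
      uniqueness; for \<open>t = 0\<close> the point is \<open>y0\<close> itself.\<close>
    define \<epsilon> where "\<epsilon> = min b (\<delta> u)"
    have \<epsilon>: "\<epsilon> > 0" "\<epsilon> \<le> \<delta> u" "\<epsilon> \<le> b" using b \<delta> norm_u by (auto simp: \<epsilon>_def)
    have ex1: "\<exists>!x. cone_rel y0 u (\<delta> u) t x" if t: "0 \<le> t" "t < \<epsilon>" for t
    proof -
      have "\<exists>x. cone_rel y0 u (\<delta> u) t x"
      proof (cases "t = 0")
        case True
        then have "cone_rel y0 u (\<delta> u) t y0" using y0 by (simp add: cone_rel_def)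
        then show ?thesis ..
      next
        case False
        then show ?thesis using b(2)[of t] t \<epsilon> by (simp add: N_def)
      qed
      then show ?thesis using unique[OF norm_u, of t] t \<epsilon> by auto
    qed
    note arc = arc_in_cone[OF y0 \<delta>[OF norm_u] \<epsilon>(1) ex1, folded \<Gamma>_def]
    obtain v where v: "norm v = 1" "has_unit_tangent (\<Gamma> u) y0 v" using arc(2) by blast
    have "cone_rel y0 u (\<delta> u) t x \<longleftrightarrow> x = \<Gamma> u t" if "0 \<le> t" "t < \<epsilon>" for t x
      using theI'[OF ex1[OF that]] ex1[OF that] unfolding \<Gamma>_def by blast
    then show "\<exists>\<epsilon>v. fst \<epsilon>v > 0 \<and> (\<forall>t. 0 \<le> t \<and> t < fst \<epsilon>v \<longrightarrow> (\<forall>x. cone_rel y0 u (\<delta> u) t x \<longleftrightarrow> x = \<Gamma> u t)) \<and>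
      definable_arc S y0 (fst \<epsilon>v) (\<Gamma> u) \<and> norm (snd \<epsilon>v) = 1 \<and> has_unit_tangent (\<Gamma> u) y0 (snd \<epsilon>v)"
      using \<epsilon>(1) arc(1) v by (intro exI[of _ "(\<epsilon>, v)"]) simp
  qed
  from bchoice[OF this] obtain \<epsilon>v where \<epsilon>v: "\<forall>u\<in>G. fst (\<epsilon>v u) > 0 \<and>
      (\<forall>t. 0 \<le> t \<and> t < fst (\<epsilon>v u) \<longrightarrow> (\<forall>x. cone_rel y0 u (\<delta> u) t x \<longleftrightarrow> x = \<Gamma> u t)) \<and>
      definable_arc S y0 (fst (\<epsilon>v u)) (\<Gamma> u) \<and> norm (snd (\<epsilon>v u)) = 1 \<and> has_unit_tangent (\<Gamma> u) y0 (snd (\<epsilon>v u))"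
    by blast
  define \<epsilon> where "\<epsilon> u = fst (\<epsilon>v u)" for u
  define v where "v u = snd (\<epsilon>v u)" for u
  have \<epsilon>_pos: "\<epsilon> u > 0" and \<Gamma>: "0 \<le> t \<Longrightarrow> t < \<epsilon> u \<Longrightarrow> cone_rel y0 u (\<delta> u) t x \<longleftrightarrow> x = \<Gamma> u t"
    and arc: "definable_arc S y0 (\<epsilon> u) (\<Gamma> u)" and norm_v: "norm (v u) = 1"
    and tangent: "has_unit_tangent (\<Gamma> u) y0 (v u)" if "u \<in> G" for u t x
    using bspec[OF \<epsilon>v that] unfolding \<epsilon>_def v_def by blast+
  have small: "eventually (\<lambda>t. 0 < t \<and> t < b) (at_right 0)" if "b > 0" for b :: real
    using that by (auto simp: eventually_at_right_field)
  have in_tangent_cone: "eventually (\<lambda>t. cone_rel y0 (v u) (\<delta> (v u)) t (\<Gamma> u t)) (at_right 0)"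
    if u: "u \<in> G" for u
  proof -
    have "eventually (\<lambda>t. dist ((\<Gamma> u t - y0) /\<^sub>R norm (\<Gamma> u t - y0)) (v u) < \<delta> (v u)) (at_right 0)"
      using tendstoD[OF tangent[OF u, unfolded has_unit_tangent_def]] \<delta>[OF norm_v[OF u]] by blast
    then show ?thesis using small[OF \<epsilon>_pos[OF u]]
    proof eventually_elim
      case (elim t)
      then have rel: "\<Gamma> u t \<in> Conf k X" "dist y0 (\<Gamma> u t) = t"
        using \<Gamma>[OF u, of t "\<Gamma> u t"] by (auto simp: cone_rel_def)
      then have "norm ((\<Gamma> u t - y0) /\<^sub>R t - v u) \<le> \<delta> (v u)"
        using elim by (simp add: dist_norm norm_minus_commute)
      moreover have "\<Gamma> u t - y0 - t *\<^sub>R v u = t *\<^sub>R ((\<Gamma> u t - y0) /\<^sub>R t - v u)"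
        using elim by (simp add: scaleR_diff_right)
      ultimately have "norm (\<Gamma> u t - y0 - t *\<^sub>R v u) \<le> \<delta> (v u) * t"
        using elim by (simp add: mult.commute)
      then show ?case using rel by (simp add: cone_rel_def)
    qed
  qed
  \<comment> \<open>Several cones may produce curves with the same tangent; one of them is kept for
    each tangent.\<close>
  define rep where "rep = inv_into G v"
  have rep: "rep w \<in> G" "v (rep w) = w" if "w \<in> v ` G" for w
    using that by (simp_all add: rep_def inv_into_into f_inv_into_f)
  \<comment> \<open>Near \<open>y0\<close> both curves lie in the cone around their common tangent,
    where a conflict point is determined by its distance from \<open>y0\<close>.\<close>
  have agree: "eventually (\<lambda>t. \<Gamma> u t = \<Gamma> (rep (v u)) t) (at_right 0)" if u: "u \<in> G" for u
  proof -
    have r: "rep (v u) \<in> G" "v (rep (v u)) = v u" using rep u by auto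
    show ?thesis
      using in_tangent_cone[OF u] in_tangent_cone[OF r(1)] small[OF \<delta>[OF norm_v[OF u]]]
    proof eventually_elim
      case (elim t)
      then show ?case using unique[OF norm_v[OF u], of t] r(2) by simp
    qed
  qed
  have "finite G" using F(2) by (simp add: G_def)
  have "eventually (\<lambda>t. (\<forall>u\<in>F - G. \<not> N u t) \<and>
      (\<forall>u\<in>G. \<Gamma> u t = \<Gamma> (rep (v u)) t \<and> t < \<epsilon> u \<and> t < \<epsilon> (rep (v u)))) (at_right 0)"
    using F(2) \<open>finite G\<close>
    by (intro eventually_conj eventually_ball_finite finite_Diff ballI)
      (auto intro: not_G agree eventually_mono[OF small[OF \<epsilon>_pos]] rep(1)[OF imageI])
  then obtain \<rho> where \<rho>: "\<rho> > 0"
    and \<rho>_F: "\<And>t u. 0 < t \<Longrightarrow> t < \<rho> \<Longrightarrow> u \<in> F \<Longrightarrow> N u t \<Longrightarrow> u \<in> G"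
    and \<rho>_G: "\<And>t u. 0 < t \<Longrightarrow> t < \<rho> \<Longrightarrow> u \<in> G \<Longrightarrow> \<Gamma> u t = \<Gamma> (rep (v u)) t \<and> t < \<epsilon> u \<and> t < \<epsilon> (rep (v u))"
    unfolding eventually_at_right_field by (metis DiffI)
  have covered: "\<exists>w\<in>v ` G. \<exists>t\<in>{0..<\<epsilon> (rep w)}. x = \<Gamma> (rep w) t"
    if x: "x \<in> Conf k X" "x \<noteq> y0" "dist y0 x < \<rho>" for x
  proof -
    define t where "t = dist y0 x"
    have t: "0 < t" "t < \<rho>" using x by (simp_all add: t_def)
    define d where "d = (x - y0) /\<^sub>R t"
    have "d \<in> sphere 0 1" using t by (simp add: d_def t_def dist_norm norm_minus_commute)
    \<comment> \<open>The direction \<open>d\<close> of \<open>x\<close> is within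
      \<open>\<delta> u\<close> of some \<open>u\<close> in the cover, so scaling by
      \<open>t\<close> puts \<open>x\<close> in the cone of \<open>u\<close>.\<close>
    then obtain u where u: "u \<in> F" "dist u d < \<delta> u" using F(3) by auto
    have "x - y0 - t *\<^sub>R u = t *\<^sub>R (d - u)" using t by (simp add: d_def scaleR_diff_right)
    then have "norm (x - y0 - t *\<^sub>R u) \<le> \<delta> u * t"
      using t u by (simp add: dist_norm norm_minus_commute mult.commute)
    then have rel: "cone_rel y0 u (\<delta> u) t x" using x by (simp add: cone_rel_def t_def)
    then have G: "u \<in> G" using \<rho>_F[OF t u(1)] by (auto simp: N_def)
    note \<rho>_u = \<rho>_G[OF t G]
    have "x = \<Gamma> u t" using \<Gamma>[OF G, of t x] \<rho>_u rel t by simp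
    also have "\<dots> = \<Gamma> (rep (v u)) t" using \<rho>_u by blast
    finally show ?thesis using \<rho>_u G t by (metis imageI atLeastLessThan_iff less_imp_le)
  qed
  \<comment> \<open>The arcs are numbered through their tangents, so distinctness of the tangents is
    injectivity of \<open>h\<close>.\<close>
  define s where "s = card (v ` G)"
  obtain h where h: "bij_betw h {1..s} (v ` G)"
    using ex_bij_betw_nat_finite_1[of "v ` G"] \<open>finite G\<close> unfolding s_def by blast
  have h_in: "h i \<in> v ` G" if "i \<in> {1..s}" for i using h that by (auto simp: bij_betw_def)
  have zero: "\<Gamma> u 0 = y0" if "u \<in> G" for u using arc[OF that] by (simp add: definable_arc_def)
  show ?thesis
  proof (intro exI conjI)
    show "\<forall>i\<in>{1..s}. definable_arc S y0 (\<epsilon> (rep (h i))) (\<Gamma> (rep (h i))) \<and>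
        has_unit_tangent (\<Gamma> (rep (h i))) y0 (h i)"
      using arc tangent rep h_in by metis
    show "\<forall>i\<in>{1..s}. \<forall>j\<in>{1..s}. i \<noteq> j \<longrightarrow> h i \<noteq> h j"
      using bij_betw_imp_inj_on[OF h] by (blast dest: inj_onD)
    have "(\<Union>i\<in>{1..s}. \<Gamma> (rep (h i)) ` {0..<\<epsilon> (rep (h i))}) = (\<Union>w\<in>h ` {1..s}. \<Gamma> (rep w) ` {0..<\<epsilon> (rep w)})"
      by simp
    also have "\<dots> = (\<Union>w\<in>v ` G. \<Gamma> (rep w) ` {0..<\<epsilon> (rep w)})" (is "_ = ?A")
      using bij_betw_imp_surj_on[OF h] by (simp only:)
    finally have union: "(\<Union>i\<in>{1..s}. \<Gamma> (rep (h i)) ` {0..<\<epsilon> (rep (h i))}) = ?A" .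
    have "x \<in> ?A" if x: "x \<in> Conf k X" "x \<in> ball y0 \<rho>" for x
    proof (cases "x = y0")
      case True
      \<comment> \<open>The point \<open>y0\<close> lies on an arc only if there is an arc at all; a
        conflict point near \<open>y0\<close> provides one.\<close>
      obtain x' where "x' \<in> Conf k X" "x' \<noteq> y0" "dist y0 x' < \<rho>"
        using Conf_accumulates[OF y0 \<rho>] by blast
      then obtain w where w: "w \<in> v ` G" using covered by blast
      have "x = \<Gamma> (rep w) 0" using zero[OF rep(1)[OF w]] True by simp
      moreover have "0 \<in> {0..<\<epsilon> (rep w)}" using \<epsilon>_pos[OF rep(1)[OF w]] by simp
      ultimately show ?thesis using w by blast
    next
      case False
      have "dist y0 x < \<rho>" using x(2) by simp
      from covered[OF x(1) False this] show ?thesis by blast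
    qed
    moreover have "x \<in> Conf k X" if "x \<in> ?A" for x
    proof -
      from that obtain w t where w: "w \<in> v ` G" and t: "t \<in> {0..<\<epsilon> (rep w)}" "x = \<Gamma> (rep w) t"
        by blast
      then show "x \<in> Conf k X"
        using \<Gamma>[OF rep(1)[OF w], of t x] by (simp add: cone_rel_def)
    qed
    ultimately have "Conf k X \<inter> ball y0 \<rho> = ?A \<inter> ball y0 \<rho>" by blast
    then show "same_germ y0 (Conf k X) (\<Union>i\<in>{1..s}. \<Gamma> (rep (h i)) ` {0..<\<epsilon> (rep (h i))})"
      unfolding union same_germ_def using \<rho> by (intro exI[of _ "ball y0 \<rho>"] conjI) simp_all
  qed
qed

end

theorem theorem2p7:
  fixes S :: "nat \<Rightarrow> real list set set"
    and k :: nat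
    and X :: "nat \<Rightarrow> (real ^ 2) set"
    and y0 :: "real ^ 2"
  assumes "o_minimal_field_expansion S"
    and "\<And>i. i \<in> {1..k} \<Longrightarrow> X i \<noteq> {}"
    and "\<And>i. i \<in> {1..k} \<Longrightarrow> closed (X i)"
    and "\<And>i. i \<in> {1..k} \<Longrightarrow> definable_set S (X i)"
    and "\<And>i j. i \<in> {1..k} \<Longrightarrow> j \<in> {1..k} \<Longrightarrow> i \<noteq> j \<Longrightarrow> X i \<inter> X j = {}"
    and "y0 \<in> Conf k X"
  shows "\<exists>(s::nat) (\<gamma> :: nat \<Rightarrow> real \<Rightarrow> real ^ 2) (\<epsilon> :: nat \<Rightarrow> real) (u :: nat \<Rightarrow> real ^ 2).
           (\<forall>i\<in>{1..s}. definable_arc S y0 (\<epsilon> i) (\<gamma> i) \<and> has_unit_tangent (\<gamma> i) y0 (u i)) \<and>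
           (\<forall>i\<in>{1..s}. \<forall>j\<in>{1..s}. i \<noteq> j \<longrightarrow> u i \<noteq> u j) \<and>
           same_germ y0 (Conf k X) (\<Union>i\<in>{1..s}. \<gamma> i ` {0..<\<epsilon> i})"
proof -
  interpret o_minimal_field_expansion S by (rule assms(1))
  interpret definable_family S k X by unfold_locales (use assms(2-5) in auto)
  show ?thesis by (rule Conf_germ_arcs[OF assms(6)])
qed

end
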